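(* Let $\mathbf t=(t_1,\ldots,t_n)^\top\in\mathcal D$ with $t_1>0$, and let $\Delta\in\mathcal M^{\geq}$ be invertible with eigenvalues $\lambda_1\geq\ldots\geq\lambda_n$. (i) If $p\in[2,+\infty)$, then $m(\Delta;\mathcal S_{\mathbf t,p})=t_1^{-2/p}\lambda_n$. (ii) If $p\in(0,2)$, then $$m(\Delta;\mathcal S_{\mathbf t,p})=\left(\sum_{j=1}^n\left(t_j^{2/p}\lambda_{n-j+1}^{-1}\right)^{p/(2-p)}\right)^{(p-2)/p},$$ and $\mathcal S_{\mathbf t,p}(\Delta)$ is the set of all $A$ of the form $$A=\left(\sum_{j=1}^n\left(t_j^{2/p}\lambda_{n-j+1}^{-1}\right)^{p/(2-p)}\right)^{-1/p}V\,\mathrm{diag}\left((t_1\lambda_n^{-1})^{1/(2-p)},(t_2\lambda_{n-1}^{-1})^{1/(2-p)},\ldots,(t_n\lambda_1^{-1})^{1/(2-p)}\right)U^*$$ with $V\in\mathcal U$ and $U\in\mathcal U_\Delta$.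
   Context: $n$ is a positive integer, $\mathcal M$ is the algebra of complex $n\times n$ matrices, $\mathcal U$ the set of unitary matrices in $\mathcal M$, $\mathcal M^{\geq}$ the cone of non-negative Hermitian matrices in $\mathcal M$. $\mathcal D=\{(x_1,\ldots,x_n)^\top\in[0,+\infty)^n:x_1\geq\ldots\geq x_n\}$. Singular values of $A\in\mathcal M$ are ordered decreasingly: $\sigma_1(A)\geq\ldots\geq\sigma_n(A)$. For $p\in(0,+\infty)$, $\phi_{\mathbf t,p}(A)=\left(\sum_{j=1}^nt_j\sigma_j(A)^p\right)^{1/p}$ and $\mathcal S_{\mathbf t,p}=\{A\in\mathcal M:\phi_{\mathbf t,p}(A)=1\}$. $\mathcal U_\Delta$ is the set of all $U\in\mathcal U$ with $\Delta=U\,\mathrm{diag}(\lambda_n,\ldots,\lambda_1)\,U^*$. For a non-empty $\mathcal A\subseteq\mathcal M$, $m(\Delta;\mathcal A)$ denotes $\inf\{\mathrm{tr}(A\Delta A^* ):A\in\mathcal A\}$ when this infimum is attained; an assertion $m(\Delta;\mathcal A)=c$ means that the infimum is attained and equals $c$; $\mathcal A(\Delta)$ denotes the set of all $A\in\mathcal A$ at which the infimum is attained (so $\mathcal S_{\mathbf t,p}(\Delta)$ is the set of minimizers over $\mathcal S_{\mathbf t,p}$). *)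

theory Defs
  imports
    "Jordan_Normal_Form.Schur_Decomposition"
    "Jordan_Normal_Form.Char_Poly"
    "HOL-Library.Multiset"
begin

definition mat_trace :: "complex mat \<Rightarrow> complex" where
  "mat_trace A = (\<Sum>i<dim_row A. A $$ (i, i))"

definition unitaries :: "nat \<Rightarrow> complex mat set" where
  "unitaries n = {U \<in> carrier_mat n n. mat_adjoint U * U = 1\<^sub>m n \<and> U * mat_adjoint U = 1\<^sub>m n}"

definition nonneg_hermitian :: "nat \<Rightarrow> complex mat set" where
  "nonneg_hermitian n = {A \<in> carrier_mat n n. mat_adjoint A = A \<and>
     (\<forall>v \<in> carrier_vec n. Re ((A *\<^sub>v v) \<bullet>c v) \<ge> 0)}"

text \<open>
  Vectors in \<open>\<real>\<^sup>n\<close> are functions on \<^typ>\<open>nat\<close> of which only the values at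
  \<open>1, \<dots>, n\<close> matter.
\<close>

definition decreasing_cone :: "nat \<Rightarrow> (nat \<Rightarrow> real) set" where
  "decreasing_cone n = {x. (\<forall>j \<in> {1..n}. 0 \<le> x j) \<and>
     (\<forall>i \<in> {1..n}. \<forall>j \<in> {1..n}. i \<le> j \<longrightarrow> x j \<le> x i)}"

text \<open>
  \<open>diag n d\<close> has diagonal entries \<open>d 1, \<dots>, d n\<close>; the indices of \<^const>\<open>mat_diag\<close>
  start at 0.
\<close>

definition diag :: "nat \<Rightarrow> (nat \<Rightarrow> real) \<Rightarrow> complex mat" where
  "diag n d = mat_diag n (\<lambda>i. complex_of_real (d (Suc i)))"

text \<open>
  \<open>eig A j\<close> is the \<open>j\<close>-th largest eigenvalue (\<open>1 \<le> j \<le> n\<close>, counted with algebraic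
  multiplicity) of an \<open>n \<times> n\<close> matrix \<open>A\<close>. It is only used for Hermitian \<open>A\<close>, whose
  eigenvalues are real, so that taking real parts loses nothing.
\<close>

definition eig :: "complex mat \<Rightarrow> nat \<Rightarrow> real" where
  "eig A j = rev (sorted_list_of_multiset (image_mset Re (proots (char_poly A)))) ! (j - 1)"

definition sing_val :: "complex mat \<Rightarrow> nat \<Rightarrow> real" where
  "sing_val A j = sqrt (eig (mat_adjoint A * A) j)"

definition phi :: "nat \<Rightarrow> (nat \<Rightarrow> real) \<Rightarrow> real \<Rightarrow> complex mat \<Rightarrow> real" where
  "phi n t p A = (\<Sum>j = 1..n. t j * sing_val A j powr p) powr (1 / p)"

definition unit_sphere :: "nat \<Rightarrow> (nat \<Rightarrow> real) \<Rightarrow> real \<Rightarrow> complex mat set" where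
  "unit_sphere n t p = {A \<in> carrier_mat n n. phi n t p A = 1}"

definition diagonalizers :: "nat \<Rightarrow> complex mat \<Rightarrow> complex mat set" where
  "diagonalizers n \<Delta> = {U \<in> unitaries n.
     \<Delta> = U * diag n (\<lambda>j. eig \<Delta> (n - j + 1)) * mat_adjoint U}"

text \<open>
  For Hermitian \<open>\<Delta>\<close> the trace of \<open>A \<Delta> A\<^sup>*\<close> is real.
\<close>

definition objective :: "complex mat \<Rightarrow> complex mat \<Rightarrow> real" where
  "objective \<Delta> A = Re (mat_trace (A * \<Delta> * mat_adjoint A))"

text \<open>
  The infimum of the objective over a set is attained and equals \<open>c\<close>. Boundedness below is
  part of the definition because \<^const>\<open>Inf\<close> on the reals is unspecified without it; a set
  on which the infimum is attained is non-empty.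
\<close>

definition has_min :: "complex mat \<Rightarrow> complex mat set \<Rightarrow> real \<Rightarrow> bool" where
  "has_min \<Delta> \<A> c \<longleftrightarrow> bdd_below (objective \<Delta> ` \<A>) \<and>
     Inf (objective \<Delta> ` \<A>) = c \<and> (\<exists>A \<in> \<A>. objective \<Delta> A = c)"

definition minimizers :: "complex mat \<Rightarrow> complex mat set \<Rightarrow> complex mat set" where
  "minimizers \<Delta> \<A> = {A \<in> \<A>. has_min \<Delta> \<A> (objective \<Delta> A)}"

end

theory Submission
  imports Defs "HOL-Analysis.Convex"
begin

text \<open>
  Write \<open>\<beta>\<^sub>j = \<sigma>\<^sub>j(A)\<^sup>2\<close> for the eigenvalues of \<open>B = A\<^sup>* A\<close> in decreasing order and
  \<open>\<mu>\<^sub>j = \<lambda>\<^bsub>n-j+1\<^esub>\<close> for those of \<open>\<Delta>\<close> in increasing order. The objective is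
  \<open>tr (A \<Delta> A\<^sup>*) = tr (B \<Delta>)\<close>, while the constraint sees only the \<open>\<sigma>\<^sub>j\<close>. So the problem
  splits in two: for given singular values, rotate \<open>B\<close> optimally against \<open>\<Delta>\<close>; then choose the
  singular values.

  For the rotation, \<open>tr (B \<Delta>) = \<Sum>\<^sub>i\<^sub>j \<beta>\<^sub>i \<mu>\<^sub>j P\<^sub>i\<^sub>j\<close>, where \<open>P\<close> consists of the squared moduli
  of the entries of a unitary matrix and is therefore doubly stochastic. The doubly stochastic form
  of the rearrangement inequality (\<open>doubly_stochastic_rearrangement\<close>) bounds this below by
  \<open>\<Sum>\<^sub>j \<beta>\<^sub>j \<mu>\<^sub>j\<close>, which is \<open>trace_inequality\<close>. In the case of equality \<open>B\<close> and \<open>\<Delta>\<close> have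
  a common ordered eigenbasis (\<open>trace_equality_simultaneous\<close>): this basis is found by
  diagonalizing \<open>\<Delta> - B\<close> with increasing eigenvalues. The singular value decomposition along that
  basis (\<open>singular_value_decomposition\<close>) then gives \<open>A = V diag(\<sigma>) U\<^sup>*\<close> with
  \<open>U\<close> diagonalizing \<open>\<Delta>\<close> (\<open>objective_bound_tight\<close>).

  It remains to minimize \<open>\<Sum>\<^sub>j \<sigma>\<^sub>j\<^sup>2 \<mu>\<^sub>j\<close> subject to \<open>\<Sum>\<^sub>j t\<^sub>j \<sigma>\<^sub>j\<^sup>p = 1\<close>. For \<open>p \<ge> 2\<close> the
  \<open>p\<close>-norm is at most the \<open>2\<close>-norm, so \<open>1 \<le> t\<^sub>1 (\<Sum>\<^sub>j \<sigma>\<^sub>j\<^sup>2)\<^bsup>p/2\<^esup>\<close>, and all weight goes to the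
  smallest eigenvalue \<open>\<mu>\<^sub>1 = \<lambda>\<^sub>n\<close>. For \<open>p < 2\<close> put \<open>x\<^sub>j = \<sigma>\<^sub>j\<^sup>2 \<mu>\<^sub>j\<close> and \<open>q = p/2 < 1\<close>: a linear
  form is minimized under a concave constraint, so Hoelder's inequality with its equality
  case (\<open>weighted_powr_sum_minimum\<close>) yields both the minimum and a unique optimal vector of
  singular values. This vector is decreasing because \<open>t\<^sub>j\<close> decreases and \<open>\<mu>\<^sub>j\<close> increases, so it
  is attained, precisely by the matrices in the stated family.
\<close>

section \<open>Adjoints, unitary matrices and the spectral theorem\<close>

lemma mat_adjoint_index [simp]:
  fixes A :: "complex mat"
  assumes "i < dim_col A" "j < dim_row A"
  shows "mat_adjoint A $$ (i, j) = cnj (A $$ (j, i))"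
  using assms by (simp add: mat_adjoint_def mat_of_rows_index)

lemma mat_adjoint_dim [simp]:
  "dim_row (mat_adjoint A) = dim_col A" "dim_col (mat_adjoint A) = dim_row A"
  by (auto simp: mat_adjoint_def)

lemma mat_adjoint_carrier [simp]:
  "A \<in> carrier_mat n m \<Longrightarrow> mat_adjoint A \<in> carrier_mat m n"
  by (intro carrier_matI) auto

lemma mat_adjoint_adjoint [simp]:
  fixes A :: "complex mat" shows "mat_adjoint (mat_adjoint A) = A"
  by (rule eq_matI) auto

lemma mat_adjoint_mult:
  fixes A B :: "complex mat"
  assumes "A \<in> carrier_mat n m" "B \<in> carrier_mat m k"
  shows "mat_adjoint (A * B) = mat_adjoint B * mat_adjoint A"
  using assms by (intro eq_matI) (auto simp: scalar_prod_def intro!: sum.cong)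

lemma mat_adjoint_add:
  fixes A B :: "complex mat"
  assumes "A \<in> carrier_mat n m" "B \<in> carrier_mat n m"
  shows "mat_adjoint (A + B) = mat_adjoint A + mat_adjoint B"
  using assms by (intro eq_matI) auto

lemma mat_adjoint_diff:
  fixes A B :: "complex mat"
  assumes "A \<in> carrier_mat n m" "B \<in> carrier_mat n m"
  shows "mat_adjoint (A - B) = mat_adjoint A - mat_adjoint B"
  using assms by (intro eq_matI) auto

lemma mat_adjoint_mat_diag [simp]:
  "mat_adjoint (mat_diag n f) = mat_diag n (\<lambda>i. cnj (f i))"
  by (intro eq_matI) (auto simp: mat_diag_def)

lemma mat_adjoint_one [simp]: "mat_adjoint (1\<^sub>m n :: complex mat) = 1\<^sub>m n"
  by (intro eq_matI) auto

text \<open>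
  Rewriting to right-nested products of square matrices; the dimension has to be supplied because
  it does not occur in the left-hand sides.
\<close>

lemmas square_simps = assoc_mult_mat[of _ n n _ n _ n] mult_carrier_mat[of _ n n _ n]
  mat_adjoint_mult[of _ n n _ n] mat_adjoint_carrier[of _ n n] for n

lemma unitariesD:
  assumes "U \<in> unitaries n"
  shows unitaries_carrier: "U \<in> carrier_mat n n"
    and unitaries_left: "mat_adjoint U * U = 1\<^sub>m n"
    and unitaries_right: "U * mat_adjoint U = 1\<^sub>m n"
  using assms by (auto simp: unitaries_def)

lemma unitary_cancel:
  assumes "U \<in> unitaries n" "X \<in> carrier_mat n k"
  shows "mat_adjoint U * (U * X) = X" "U * (mat_adjoint U * X) = X"
proof -
  note U = unitariesD[OF assms(1)]
  have "mat_adjoint U * (U * X) = (mat_adjoint U * U) * X"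
    by (rule assoc_mult_mat[symmetric]) (use U(1) assms(2) in auto)
  thus "mat_adjoint U * (U * X) = X" using U(2) assms(2) by simp
  have "U * (mat_adjoint U * X) = (U * mat_adjoint U) * X"
    by (rule assoc_mult_mat[symmetric]) (use U(1) assms(2) in auto)
  thus "U * (mat_adjoint U * X) = X" using U(3) assms(2) by simp
qed

lemma unitariesI:
  assumes "U \<in> carrier_mat n n" "mat_adjoint U * U = 1\<^sub>m n"
  shows "U \<in> unitaries n"
  using assms mat_mult_left_right_inverse[of "mat_adjoint U" n U]
  by (auto simp: unitaries_def)

lemma one_unitary [simp]: "1\<^sub>m n \<in> unitaries n"
  by (rule unitariesI) auto

lemma adjoint_unitary: "U \<in> unitaries n \<Longrightarrow> mat_adjoint U \<in> unitaries n"
  by (auto simp: unitaries_def)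

lemma mult_unitary:
  assumes "U \<in> unitaries n" "W \<in> unitaries n"
  shows "U * W \<in> unitaries n"
proof -
  note [simp] = unitaries_carrier[OF assms(1)] unitaries_carrier[OF assms(2)]
  show ?thesis
    by (rule unitariesI) (simp_all add: square_simps[where n=n]
        unitary_cancel[OF assms(1), of _ n] unitaries_left[OF assms(2)])
qed

lemma unitary_conj_cancel:
  assumes U: "U \<in> unitaries n" and X: "X \<in> carrier_mat n n"
  shows "U * (mat_adjoint U * X * U) * mat_adjoint U = X"
    "mat_adjoint U * (U * X * mat_adjoint U) * U = X"
proof -
  note [simp] = unitaries_carrier[OF U] X
  show "U * (mat_adjoint U * X * U) * mat_adjoint U = X"
    "mat_adjoint U * (U * X * mat_adjoint U) * U = X"
    by (simp_all add: square_simps[where n=n] unitary_cancel[OF U, of _ n] unitaries_left[OF U]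
        unitaries_right[OF U] right_mult_one_mat[OF X])
qed

text \<open>
  Complete \<open>v\<close> to a basis, orthogonalize it by Gram-Schmidt and normalize the columns. Column 0 is
  only known up to the normalizing factor.
\<close>

lemma unitary_with_first_column:
  fixes v :: "complex vec"
  assumes v: "v \<in> carrier_vec n" and v0: "v \<noteq> 0\<^sub>v n"
  obtains U c where "U \<in> unitaries n" "c \<noteq> 0" "col U 0 = c \<cdot>\<^sub>v v"
proof -
  interpret cof_vec_space n "TYPE(complex)" .
  define b where "b = basis_completion v"
  define ws where "ws = gram_schmidt n b"
  define W where "W = mat_of_cols n ws"
  from basis_completion[OF v v0, folded b_def]
  have dist_b: "distinct b" and indep: "\<not> lin_dep (set b)" and b: "set b \<subseteq> carrier_vec n"
    and hdb: "hd b = v" and len_b: "length b = n" by auto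
  have n: "n > 0" using v v0 by (intro gr0I) auto
  from hdb len_b n obtain vs where bv: "b = v # vs" by (cases b, auto)
  from gram_schmidt_result[OF b dist_b indep refl, folded ws_def]
  have ws: "set ws \<subseteq> carrier_vec n" "corthogonal ws" "length ws = n"
    by (auto simp: len_b)
  from gram_schmidt_hd[OF v, of vs, folded bv] have hdws: "hd ws = v" unfolding ws_def .
  have W: "W \<in> carrier_mat n n"
    using ws unfolding W_def using mat_of_cols_carrier(1)[of n ws] by auto
  have orth: "corthogonal_mat W" using orthogonal_mat_of_cols ws unfolding W_def .
  define G where "G = mat_adjoint W * W"
  have G: "G \<in> carrier_mat n n" using W by (auto simp: G_def)
  define g where "g i = (\<Sum>k<n. (cmod (W $$ (k, i)))\<^sup>2)" for i
  have G_diag: "G $$ (i, i) = of_real (g i)" if "i < n" for i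
    using that W by (auto simp: G_def g_def scalar_prod_def complex_norm_square[symmetric]
        mult.commute atLeast0LessThan intro!: sum.cong)
  have G_off: "G $$ (i, j) = 0" if "i < n" "j < n" "i \<noteq> j" for i j
    using orth that W by (auto simp: corthogonal_mat_def Let_def diagonal_mat_def G_def)
  have g_pos: "g i > 0" if "i < n" for i
  proof -
    have "G $$ (i, i) \<noteq> 0" using orth that W by (auto simp: corthogonal_mat_def Let_def G_def)
    hence "g i \<noteq> 0" using G_diag[OF that] by auto
    moreover have "g i \<ge> 0" by (auto simp: g_def intro!: sum_nonneg)
    ultimately show ?thesis by simp
  qed
  \<comment> \<open>The Gram matrix \<open>G\<close> is diagonal with entries \<open>g\<close>, so scaling by \<open>D\<close> makes it the identity.\<close>
  define D where "D = mat_diag n (\<lambda>i. complex_of_real (1 / sqrt (g i)))"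
  have D: "D \<in> carrier_mat n n" "mat_adjoint D = D" by (auto simp: D_def)
  have "mat_adjoint (W * D) * (W * D) = D * G * D"
    using W D by (simp add: G_def square_simps[where n=n])
  also have "\<dots> = 1\<^sub>m n"
  proof (rule eq_matI)
    fix i j assume "i < dim_row (1\<^sub>m n :: complex mat)" "j < dim_col (1\<^sub>m n :: complex mat)"
    hence ij: "i < n" "j < n" by auto
    have "(D * G * D) $$ (i, j) = of_real (1 / sqrt (g i)) * G $$ (i, j) * of_real (1 / sqrt (g j))"
      unfolding D_def using G ij
      by (subst mat_diag_mult_left[of _ n n], simp, subst mat_diag_mult_right[of _ n], auto)
    also have "\<dots> = 1\<^sub>m n $$ (i, j)"
    proof (cases "i = j")
      case True
      have "complex_of_real (1 / sqrt (g i)) * of_real (g i) * of_real (1 / sqrt (g i))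
          = of_real (1 / sqrt (g i) * g i * (1 / sqrt (g i)))" by (simp only: of_real_mult)
      also have "1 / sqrt (g i) * g i * (1 / sqrt (g i)) = 1"
        using g_pos[OF ij(1)] by (simp add: field_simps)
      finally show ?thesis using True ij G_diag[OF ij(1)] by simp
    qed (use ij G_off in auto)
    finally show "(D * G * D) $$ (i, j) = 1\<^sub>m n $$ (i, j)" .
  qed (use D G in auto)
  finally have "W * D \<in> unitaries n" using W D by (intro unitariesI) auto
  moreover have "col (W * D) 0 = of_real (1 / sqrt (g 0)) \<cdot>\<^sub>v v"
  proof -
    have "col W 0 = v" using ws hdws n v unfolding W_def by (cases ws) auto
    hence *: "W $$ (i, 0) = v $ i" if "i < n" for i
      using that W n by (metis carrier_matD index_col)
    show ?thesis
      unfolding D_def using W n v *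
      by (intro eq_vecI) (auto simp: mat_diag_mult_right[of _ n])
  qed
  moreover have "complex_of_real (1 / sqrt (g 0)) \<noteq> 0" using g_pos[OF n] by simp
  ultimately show ?thesis using that by blast
qed

lemma mat_adjoint_four_block_diag:
  fixes A B :: "complex mat"
  assumes "A \<in> carrier_mat n n" "B \<in> carrier_mat m m"
  shows "mat_adjoint (four_block_mat A (0\<^sub>m n m) (0\<^sub>m m n) B) =
    four_block_mat (mat_adjoint A) (0\<^sub>m n m) (0\<^sub>m m n) (mat_adjoint B)"
  using assms by (intro eq_matI) auto

lemma mult_four_block_diag:
  fixes A B :: "complex mat"
  assumes "A \<in> carrier_mat n n" "B \<in> carrier_mat m m" "A' \<in> carrier_mat n n" "B' \<in> carrier_mat m m"
  shows "four_block_mat A (0\<^sub>m n m) (0\<^sub>m m n) B * four_block_mat A' (0\<^sub>m n m) (0\<^sub>m m n) B' =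
    four_block_mat (A * A') (0\<^sub>m n m) (0\<^sub>m m n) (B * B')"
  using assms by (subst mult_four_block_mat[of _ n n _ m _ m _ _ n _ m]) auto

text \<open>
  Deflation: in an orthonormal basis that starts with an eigenvector for \<open>e\<close>, the first column of
  the matrix is \<open>e\<close> times the first unit vector, and by symmetry so is the first row; the remaining
  block is again Hermitian. Prescribing the list \<open>es\<close> lets the eigenvalues appear in any desired
  order on the diagonal.
\<close>

theorem spectral_theorem:
  fixes A :: "complex mat"
  assumes "A \<in> carrier_mat n n" "mat_adjoint A = A" "char_poly A = (\<Prod>e\<leftarrow>es. [:- e, 1:])"
  obtains U where "U \<in> unitaries n" "A = U * mat_diag n (\<lambda>i. es ! i) * mat_adjoint U"
  using assms
proof (induction es arbitrary: n A thesis)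
  case Nil
  have "n = 0" using degree_monic_char_poly[OF Nil(2)] Nil(4) by simp
  have "A = 1\<^sub>m n * mat_diag n (\<lambda>i. [] ! i) * mat_adjoint (1\<^sub>m n)"
    using Nil(2) \<open>n = 0\<close> by (intro eq_matI) auto
  thus ?case using Nil(1) one_unitary by blast
next
  case (Cons e es n A)
  note A = Cons.prems(2) and herm = Cons.prems(3)
  have cp: "char_poly A = [:-e, 1:] * (\<Prod>e\<leftarrow>es. [:- e, 1:])" using Cons.prems(4) by simp
  have "eigenvalue A e" unfolding eigenvalue_root_char_poly[OF A] cp by simp
  then obtain v where "eigenvector A v e" unfolding eigenvalue_def by auto
  hence v: "v \<in> carrier_vec n" "v \<noteq> 0\<^sub>v n" "A *\<^sub>v v = e \<cdot>\<^sub>v v"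
    using A unfolding eigenvector_def by auto
  have "n \<noteq> 0" using v by (intro notI) auto
  then obtain m where n: "n = Suc m" by (cases n) auto
  obtain U c where U: "U \<in> unitaries n" and c: "c \<noteq> 0" "col U 0 = c \<cdot>\<^sub>v v"
    using unitary_with_first_column[OF v(1,2)] by blast
  note Uc = unitaries_carrier[OF U]
  define A' where "A' = mat_adjoint U * A * U"
  have A': "A' \<in> carrier_mat n n" using Uc A by (auto simp: A'_def)
  have A'_adj: "mat_adjoint A' = A'" unfolding A'_def
    using Uc A herm by (simp add: square_simps[where n=n])
  have AU: "A = U * A' * mat_adjoint U"
    unfolding A'_def using unitary_conj_cancel(1)[OF U A] by simp
  have col0: "col A' 0 = e \<cdot>\<^sub>v unit_vec n 0"
  proof -
    have "A' = mat_adjoint U * (A * U)"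
      unfolding A'_def using Uc A by (simp add: square_simps[where n=n])
    moreover have "col (mat_adjoint U * (A * U)) 0 = mat_adjoint U *\<^sub>v col (A * U) 0"
      by (rule col_mult2[of _ n n _ n]) (use Uc A n in auto)
    ultimately have "col A' 0 = mat_adjoint U *\<^sub>v col (A * U) 0" by (simp only:)
    also have "col (A * U) 0 = A *\<^sub>v col U 0"
      by (rule col_mult2[of _ n n _ n]) (use Uc A n in auto)
    also have "A *\<^sub>v col U 0 = e \<cdot>\<^sub>v col U 0"
      using v A by (simp add: c smult_smult_assoc mult.commute mult_mat_vec[of _ n n])
    also have "mat_adjoint U *\<^sub>v (e \<cdot>\<^sub>v col U 0) = e \<cdot>\<^sub>v (mat_adjoint U *\<^sub>v col U 0)"
      using Uc n by (intro mult_mat_vec[of _ n n]) (auto intro!: col_carrier_vec)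
    also have "mat_adjoint U *\<^sub>v col U 0 = col (mat_adjoint U * U) 0"
      by (rule col_mult2[of _ n n _ n, symmetric]) (use Uc n in auto)
    also have "\<dots> = unit_vec n 0" using unitaries_left[OF U] n by simp
    finally show ?thesis .
  qed
  have A'_col0: "A' $$ (i, 0) = (if i = 0 then e else 0)" if "i < n" for i
    using arg_cong[OF col0, of "\<lambda>v. v $ i"] that A' n by auto
  have A'_row0: "A' $$ (0, i) = 0" if "i < n" "i \<noteq> 0" for i
    using arg_cong[OF A'_adj, of "\<lambda>X. X $$ (0, i)"] that A' n A'_col0[of i] by auto
  define A3 where "A3 = mat m m (\<lambda>(i, j). A' $$ (Suc i, Suc j))"
  define E where "E = mat 1 1 (\<lambda>_. e)"
  have A3: "A3 \<in> carrier_mat m m" by (simp add: A3_def)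
  have E: "E \<in> carrier_mat 1 1" by (simp add: E_def)
  have block: "A' = four_block_mat E (0\<^sub>m 1 m) (0\<^sub>m m 1) A3"
  proof (rule eq_matI)
    fix i j assume "i < dim_row (four_block_mat E (0\<^sub>m 1 m) (0\<^sub>m m 1) A3)"
      "j < dim_col (four_block_mat E (0\<^sub>m 1 m) (0\<^sub>m m 1) A3)"
    hence "i < n" "j < n" using A3 E n by auto
    thus "A' $$ (i, j) = four_block_mat E (0\<^sub>m 1 m) (0\<^sub>m m 1) A3 $$ (i, j)"
      using A3 E A'_col0 A'_row0 n
      by (cases i; cases j) (auto simp: A3_def E_def)
  qed (use A' A3 E n in auto)
  have "mat_adjoint A3 = A3"
  proof (rule eq_matI)
    fix i j assume "i < dim_row A3" "j < dim_col A3"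
    thus "mat_adjoint A3 $$ (i, j) = A3 $$ (i, j)"
      using arg_cong[OF A'_adj, of "\<lambda>X. X $$ (Suc i, Suc j)"] A' n
      by (auto simp: A3_def)
  qed (use A3 in auto)
  moreover have "char_poly A3 = (\<Prod>e\<leftarrow>es. [:- e, 1:])"
  proof -
    have "similar_mat A A'"
      by (rule similar_matI[of _ _ U "mat_adjoint U" n]) (use A A' Uc U AU in \<open>auto simp: unitariesD\<close>)
    hence "char_poly A' = char_poly A" using char_poly_similar by metis
    moreover have "char_poly A' = char_poly E * char_poly A3"
      unfolding block by (rule char_poly_four_block_zeros_col[OF _ _ A3]) (auto simp: E_def)
    moreover have "char_poly E = [:- e, 1:]"
      by (simp add: E_def char_poly_defs det_def sign_def)
    ultimately have "[:- e, 1:] * char_poly A3 = [:-e, 1:] * (\<Prod>e\<leftarrow>es. [:- e, 1:])"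
      using cp by simp
    thus ?thesis by (metis mult_cancel_left pCons_eq_0_iff zero_neq_one)
  qed
  ultimately obtain U3 where U3: "U3 \<in> unitaries m"
    "A3 = U3 * mat_diag m (\<lambda>i. es ! i) * mat_adjoint U3"
    using Cons.IH[OF _ A3] by blast
  note U3c = unitaries_carrier[OF U3(1)]
  define Q where "Q = four_block_mat (1\<^sub>m 1) (0\<^sub>m 1 m) (0\<^sub>m m 1) U3"
  have Q: "Q \<in> carrier_mat n n" using U3c n by (auto simp: Q_def)
  have Q_adj: "mat_adjoint Q = four_block_mat (1\<^sub>m 1) (0\<^sub>m 1 m) (0\<^sub>m m 1) (mat_adjoint U3)"
    unfolding Q_def using U3c by (subst mat_adjoint_four_block_diag) auto
  have "mat_adjoint Q * Q = 1\<^sub>m n"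
    unfolding Q_adj unfolding Q_def using U3c unitaries_left[OF U3(1)] n
    by (subst mult_four_block_diag) auto
  hence Qu: "Q \<in> unitaries n" using Q by (intro unitariesI)
  have D: "mat_diag n (\<lambda>i. (e # es) ! i) =
      four_block_mat E (0\<^sub>m 1 m) (0\<^sub>m m 1) (mat_diag m (\<lambda>i. es ! i))"
    using n by (intro eq_matI) (auto simp: mat_diag_def E_def nth_Cons')
  have "A' = Q * mat_diag n (\<lambda>i. (e # es) ! i) * mat_adjoint Q"
  proof -
    have "Q * mat_diag n (\<lambda>i. (e # es) ! i) =
        four_block_mat E (0\<^sub>m 1 m) (0\<^sub>m m 1) (U3 * mat_diag m (\<lambda>i. es ! i))"
      unfolding D Q_def using U3c E by (subst mult_four_block_diag) auto
    thus ?thesis unfolding Q_adj block U3(2)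
      using U3c E by (simp, subst mult_four_block_diag) (auto intro!: mult_carrier_mat)
  qed
  hence "A = (U * Q) * mat_diag n (\<lambda>i. (e # es) ! i) * mat_adjoint (U * Q)"
    unfolding AU using Q Uc by (simp add: square_simps[where n=n])
  with mult_unitary[OF U Qu] show ?case using Cons.prems(1) by blast
qed

section \<open>Ordered spectra\<close>

abbreviation real_diag :: "nat \<Rightarrow> (nat \<Rightarrow> real) \<Rightarrow> complex mat" where
  "real_diag n d \<equiv> mat_diag n (\<lambda>i. complex_of_real (d i))"

lemma char_poly_unitary_conj:
  assumes U: "U \<in> unitaries n"
  shows "char_poly (U * mat_diag n f * mat_adjoint U) = (\<Prod>e\<leftarrow>map f [0..<n]. [:- e, 1:])"
proof -
  note Uc = unitaries_carrier[OF U]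
  have "similar_mat (U * mat_diag n f * mat_adjoint U) (mat_diag n f)"
    by (rule similar_matI[of _ _ U "mat_adjoint U" n])
      (use Uc in \<open>auto simp: unitariesD[OF U] square_simps[where n=n]\<close>)
  hence "char_poly (U * mat_diag n f * mat_adjoint U) = char_poly (mat_diag n f)"
    by (rule char_poly_similar)
  also have "\<dots> = (\<Prod>e\<leftarrow>diag_mat (mat_diag n f). [:- e, 1:])"
    by (rule char_poly_upper_triangular[of _ n]) (auto simp: mat_diag_def)
  also have "diag_mat (mat_diag n f) = map f [0..<n]"
    by (auto simp: diag_mat_def mat_diag_def)
  finally show ?thesis .
qed

lemma proots_linear_factors:
  fixes es :: "'a :: idom list"
  shows "proots (\<Prod>e\<leftarrow>es. [:- e, 1:]) = mset es"
proof (induction es)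
  case (Cons e es)
  have "(\<Prod>e\<leftarrow>es. [:- e, 1:]) \<noteq> 0" by auto
  thus ?case using Cons by (simp add: proots_mult del: mult_pCons_left)
qed auto

lemma real_spectrum:
  assumes "U \<in> unitaries n" "A = U * real_diag n d * mat_adjoint U"
  shows "image_mset Re (proots (char_poly A)) = mset (map d [0..<n])"
  unfolding assms(2) char_poly_unitary_conj[OF assms(1)] proots_linear_factors
  by (simp flip: mset_map add: comp_def)

text \<open>
  The ordered spectrum can be read off any unitary diagonalization with monotone diagonal. This is
  how singular values of explicitly given matrices are computed below, and how two diagonalizations
  of one matrix are compared.
\<close>

lemma eig_descending:
  assumes "U \<in> unitaries n" "A = U * real_diag n d * mat_adjoint U"
    and desc: "\<And>i j. i \<le> j \<Longrightarrow> j < n \<Longrightarrow> d j \<le> d i" and "i < n"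
  shows "eig A (Suc i) = d i"
proof -
  have "sort (map d [0..<n]) = rev (map d [0..<n])"
    by (rule properties_for_sort)
      (use desc in \<open>auto simp: sorted_wrt_iff_nth_less sorted_iff_nth_mono rev_nth\<close>)
  thus ?thesis
    using \<open>i < n\<close> by (simp add: eig_def real_spectrum[OF assms(1,2)] del: mset_map)
qed

lemma eig_ascending:
  assumes "U \<in> unitaries n" "A = U * real_diag n d * mat_adjoint U"
    and asc: "\<And>i j. i \<le> j \<Longrightarrow> j < n \<Longrightarrow> d i \<le> d j" and "i < n"
  shows "eig A (n - i) = d i"
proof -
  have "sort (map d [0..<n]) = map d [0..<n]"
    by (rule properties_for_sort) (use asc in \<open>auto simp: sorted_iff_nth_mono\<close>)
  thus ?thesis
    using \<open>i < n\<close> by (simp add: eig_def real_spectrum[OF assms(1,2)] rev_nth del: mset_map)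
qed

text \<open>
  A unitary diagonalization of \<open>A\<close> has a diagonal equal to its own conjugate. Hence the real parts
  in the definition of \<^const>\<open>eig\<close> lose nothing.
\<close>

lemma hermitian_real_roots:
  fixes A :: "complex mat"
  assumes A: "A \<in> carrier_mat n n" "mat_adjoint A = A"
  obtains es where "length es = n" "image_mset Re (proots (char_poly A)) = mset es"
    "char_poly A = (\<Prod>e\<leftarrow>map complex_of_real es. [:- e, 1:])"
proof -
  obtain as where as: "char_poly A = (\<Prod>a\<leftarrow>as. [:- a, 1:])" "length as = n"
    using char_poly_factorized[OF A(1)] by blast
  obtain U where U: "U \<in> unitaries n" "A = U * mat_diag n (\<lambda>i. as ! i) * mat_adjoint U"
    using spectral_theorem[OF A as(1)] by blast
  have "mat_diag n (\<lambda>i. as ! i) = mat_adjoint U * A * U"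
    unfolding U(2) by (rule unitary_conj_cancel(2)[OF U(1), symmetric]) simp
  moreover have "mat_adjoint (mat_adjoint U * A * U) = mat_adjoint U * A * U"
    using A unitaries_carrier[OF U(1)] by (simp add: square_simps[where n=n])
  ultimately have diag_eq: "mat_diag n (\<lambda>i. cnj (as ! i)) = mat_diag n (\<lambda>i. as ! i)"
    by (metis mat_adjoint_mat_diag)
  have "cnj (as ! i) = as ! i" if "i < n" for i
    using that arg_cong[OF diag_eq, of "\<lambda>X. X $$ (i, i)"] by (simp add: mat_diag_def)
  with as(2) have *: "as = map complex_of_real (map Re as)"
    by (intro nth_equalityI) (auto simp: complex_eq_iff)
  show thesis
  proof
    show "length (map Re as) = n" using as by simp
    show "image_mset Re (proots (char_poly A)) = mset (map Re as)"
      by (simp add: as(1) proots_linear_factors)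
    show "char_poly A = (\<Prod>e\<leftarrow>map complex_of_real (map Re as). [:- e, 1:])"
      using as(1) * by simp
  qed
qed

lemma hermitian_diagonalization:
  assumes A: "A \<in> carrier_mat n n" "mat_adjoint A = A"
    and es: "mset es = image_mset Re (proots (char_poly A))"
  obtains U where "U \<in> unitaries n" "A = U * real_diag n (\<lambda>i. es ! i) * mat_adjoint U"
proof -
  obtain es' where es': "length es' = n" "image_mset Re (proots (char_poly A)) = mset es'"
    "char_poly A = (\<Prod>e\<leftarrow>map complex_of_real es'. [:- e, 1:])"
    using hermitian_real_roots[OF A] by blast
  have len: "length es = n" using es es' by (metis mset_eq_length)
  have "mset (map (\<lambda>e. [:- e, 1:]) (map complex_of_real es)) =
      mset (map (\<lambda>e. [:- e, 1:]) (map complex_of_real es'))"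
    using es es'(2) by (simp only: mset_map)
  hence "char_poly A = (\<Prod>e\<leftarrow>map complex_of_real es. [:- e, 1:])"
    unfolding es'(3) by (metis prod_mset_prod_list)
  from spectral_theorem[OF A this] obtain U where U: "U \<in> unitaries n"
    "A = U * mat_diag n (\<lambda>i. map complex_of_real es ! i) * mat_adjoint U" by blast
  have "mat_diag n (\<lambda>i. map complex_of_real es ! i) = real_diag n (\<lambda>i. es ! i)"
    using len by (intro eq_matI) (auto simp: mat_diag_def)
  with U that show ?thesis by metis
qed

lemma length_real_spectrum:
  assumes A: "A \<in> carrier_mat n n" "mat_adjoint A = A"
  shows "length (sorted_list_of_multiset (image_mset Re (proots (char_poly A)))) = n"
  using hermitian_real_roots[OF A] by (metis length_sort sorted_list_of_multiset_mset)

lemma eig_antimono: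
  assumes A: "A \<in> carrier_mat n n" "mat_adjoint A = A" and "i \<le> j" "j < n"
  shows "eig A (Suc j) \<le> eig A (Suc i)"
proof -
  have "sorted (sorted_list_of_multiset (image_mset Re (proots (char_poly A))))"
    by (rule sorted_sorted_list_of_multiset)
  thus ?thesis
    using assms(3,4) length_real_spectrum[OF A]
    by (auto simp: eig_def rev_nth intro!: sorted_nth_mono)
qed

lemma diagonalize_descending:
  assumes A: "A \<in> carrier_mat n n" "mat_adjoint A = A"
  obtains U where "U \<in> unitaries n"
    "A = U * real_diag n (\<lambda>i. eig A (Suc i)) * mat_adjoint U"
  by (rule hermitian_diagonalization[OF A,
        of "rev (sorted_list_of_multiset (image_mset Re (proots (char_poly A))))"])
    (auto simp: eig_def)

lemma diagonalize_ascending: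
  assumes A: "A \<in> carrier_mat n n" "mat_adjoint A = A"
  obtains U where "U \<in> unitaries n"
    "A = U * real_diag n (\<lambda>i. eig A (n - i)) * mat_adjoint U"
proof -
  define xs where "xs = sorted_list_of_multiset (image_mset Re (proots (char_poly A)))"
  have *: "real_diag n (\<lambda>i. xs ! i) = real_diag n (\<lambda>i. eig A (n - i))"
    using length_real_spectrum[OF A]
    by (intro eq_matI) (auto simp: mat_diag_def eig_def xs_def rev_nth)
  have "mset xs = image_mset Re (proots (char_poly A))" by (simp add: xs_def)
  from hermitian_diagonalization[OF A this] obtain U
    where "U \<in> unitaries n" "A = U * real_diag n (\<lambda>i. xs ! i) * mat_adjoint U" by blast
  thus thesis using that unfolding * by blast
qed

lemma real_diag_conj_entry:
  assumes U: "U \<in> unitaries n" and A: "A = U * real_diag n d * mat_adjoint U" and "i < n"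
  shows "of_real (d i) = (mat_adjoint U * A * U) $$ (i, i)"
  unfolding A by (subst unitary_conj_cancel(2)[OF U]) (use \<open>i < n\<close> in \<open>auto simp: mat_diag_def\<close>)

text \<open>
  The \<open>i\<close>-th diagonal entry is the quadratic form of \<open>A\<close> at the \<open>i\<close>-th eigenvector.
\<close>

lemma nonneg_hermitian_spectrum:
  assumes A: "A \<in> nonneg_hermitian n"
    and U: "U \<in> unitaries n" "A = U * real_diag n d * mat_adjoint U" and i: "i < n"
  shows "d i \<ge> 0"
proof -
  have Ac: "A \<in> carrier_mat n n" using A by (simp add: nonneg_hermitian_def)
  note Uc = unitaries_carrier[OF U(1)]
  have "of_real (d i) = (A *\<^sub>v col U i) \<bullet>c col U i"
    unfolding real_diag_conj_entry[OF U i]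
    using Ac Uc i
    by (simp add: square_simps[where n=n] scalar_prod_def mult.commute)
  moreover have "Re ((A *\<^sub>v col U i) \<bullet>c col U i) \<ge> 0"
    using A Uc i by (auto simp: nonneg_hermitian_def)
  ultimately show ?thesis by (metis Re_complex_of_real)
qed

lemma gram_hermitian:
  fixes A :: "complex mat"
  assumes "A \<in> carrier_mat n n"
  shows "mat_adjoint A * A \<in> carrier_mat n n" "mat_adjoint (mat_adjoint A * A) = mat_adjoint A * A"
  using assms by (auto simp: square_simps[where n=n])

lemma gram_diag_entry:
  fixes X :: "complex mat"
  assumes "X \<in> carrier_mat n m" "i < m"
  shows "(mat_adjoint X * X) $$ (i, i) = of_real (\<Sum>k<n. (cmod (X $$ (k, i)))\<^sup>2)"
  using assms by (auto simp: scalar_prod_def complex_norm_square[symmetric] mult.commute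
      atLeast0LessThan intro!: sum.cong)

lemma gram_spectrum:
  assumes A: "A \<in> carrier_mat n n"
    and U: "U \<in> unitaries n" "mat_adjoint A * A = U * real_diag n d * mat_adjoint U" and i: "i < n"
  shows "d i \<ge> 0"
proof -
  note Uc = unitaries_carrier[OF U(1)]
  have "of_real (d i) = (mat_adjoint (A * U) * (A * U)) $$ (i, i)"
    unfolding real_diag_conj_entry[OF U i] using A Uc by (simp add: square_simps[where n=n])
  also have "\<dots> = of_real (\<Sum>k<n. (cmod ((A * U) $$ (k, i)))\<^sup>2)"
    using A Uc i by (subst gram_diag_entry) auto
  finally have "d i = (\<Sum>k<n. (cmod ((A * U) $$ (k, i)))\<^sup>2)" using of_real_eq_iff by blast
  thus ?thesis by (simp add: sum_nonneg)
qed

lemma invertible_spectrum: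
  assumes A: "invertible_mat A"
    and U: "U \<in> unitaries n" "A = U * real_diag n d * mat_adjoint U" and i: "i < n"
  shows "d i \<noteq> 0"
proof
  assume "d i = 0"
  note Uc = unitaries_carrier[OF U(1)]
  have Ac: "A \<in> carrier_mat n n" using Uc U(2) by auto
  obtain B where B: "A * B = 1\<^sub>m n" "B * A = 1\<^sub>m (dim_row B)"
    using A Ac by (auto simp: invertible_mat_def inverts_mat_def)
  have Bc: "B \<in> carrier_mat n n"
    using Ac B by (metis carrier_matD(2) carrier_matI index_mult_mat(3) index_one_mat(3))
  have "1\<^sub>m n = mat_adjoint U * (A * B) * U" using Uc by (simp add: B(1) unitaries_left[OF U(1)])
  also have "\<dots> = real_diag n d * (mat_adjoint U * B * U)"
    unfolding U(2) using Uc Bc by (simp add: square_simps[where n=n] unitary_cancel[OF U(1), of _ n])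
  finally have "(1\<^sub>m n :: complex mat) $$ (i, i) = of_real (d i) * (mat_adjoint U * B * U) $$ (i, i)"
    using i Uc Bc by (simp add: mat_diag_mult_left[of _ n n] square_simps[where n=n])
  thus False using \<open>d i = 0\<close> i by simp
qed

section \<open>Doubly stochastic pairings and the trace inequality\<close>

definition doubly_stochastic :: "nat \<Rightarrow> (nat \<Rightarrow> nat \<Rightarrow> real) \<Rightarrow> bool" where
  "doubly_stochastic n P \<longleftrightarrow> (\<forall>i<n. \<forall>j<n. 0 \<le> P i j) \<and>
     (\<forall>i<n. (\<Sum>j<n. P i j) = 1) \<and> (\<forall>j<n. (\<Sum>i<n. P i j) = 1)"

lemma doubly_stochastic_transpose:
  "doubly_stochastic n P \<Longrightarrow> doubly_stochastic n (\<lambda>i j. P j i)"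
  by (auto simp: doubly_stochastic_def)

lemma doubly_stochastic_mult:
  assumes P: "doubly_stochastic n P" and Q: "doubly_stochastic n Q"
  shows "doubly_stochastic n (\<lambda>i j. \<Sum>k<n. P i k * Q k j)"
proof -
  have "(\<Sum>j<n. \<Sum>k<n. P i k * Q k j) = 1" if "i < n" for i
    using P Q that by (subst sum.swap) (simp add: doubly_stochastic_def flip: sum_distrib_left)
  moreover have "(\<Sum>i<n. \<Sum>k<n. P i k * Q k j) = 1" if "j < n" for j
    using P Q that by (subst sum.swap) (simp add: doubly_stochastic_def flip: sum_distrib_right)
  ultimately show ?thesis
    using P Q by (auto simp: doubly_stochastic_def intro!: sum_nonneg)
qed

lemma doubly_stochastic_permute_rows:
  assumes P: "doubly_stochastic n P" and \<pi>: "\<pi> permutes {..<n}"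
  shows "doubly_stochastic n (\<lambda>i. P (\<pi> i))"
proof -
  have "\<pi> i < n" if "i < n" for i using permutes_in_image[OF \<pi>, of i] that by simp
  moreover have "(\<Sum>i<n. P (\<pi> i) j) = (\<Sum>i<n. P i j)" for j
    using sum.permute[OF \<pi>, of "\<lambda>i. P i j"] by (simp add: comp_def)
  ultimately show ?thesis using P by (auto simp: doubly_stochastic_def)
qed

text \<open>
  Rows and columns of a unitary matrix are unit vectors.
\<close>

lemma unitary_doubly_stochastic:
  assumes U: "U \<in> unitaries n"
  shows "doubly_stochastic n (\<lambda>i j. (cmod (U $$ (i, j)))\<^sup>2)"
proof -
  have col: "(\<Sum>i<n. (cmod (V $$ (i, j)))\<^sup>2) = 1" if "V \<in> unitaries n" "j < n" for V j
  proof -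
    have "complex_of_real (\<Sum>i<n. (cmod (V $$ (i, j)))\<^sup>2) = (mat_adjoint V * V) $$ (j, j)"
      by (rule gram_diag_entry[symmetric]) (use that unitaries_carrier in auto)
    also have "\<dots> = 1" using that by (simp add: unitaries_left)
    finally show ?thesis using of_real_eq_1_iff by blast
  qed
  have row: "(\<Sum>j<n. (cmod (U $$ (i, j)))\<^sup>2) = 1" if "i < n" for i
    using col[OF adjoint_unitary[OF U] that] unitaries_carrier[OF U] that by simp
  show ?thesis using col[OF U] row by (auto simp: doubly_stochastic_def)
qed

text \<open>
  This says that \<open>\<mu> j * \<beta> i \<ge> u j + (\<mu> i * \<beta> i - u i)\<close>: the function \<open>u\<close> and its
  counterpart form a feasible solution of the linear program dual to minimizing
  \<open>\<Sum>\<^sub>i\<^sub>j \<beta> i * \<mu> j * P i j\<close> over doubly stochastic \<open>P\<close>, with equality on the diagonal. Here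
  \<open>u\<close> is a discrete integral of \<open>\<beta>\<close> with respect to \<open>\<mu>\<close>, and since \<open>\<beta>\<close> decreases it behaves
  like a concave function of \<open>\<mu>\<close>.
\<close>

lemma opposite_order_potential:
  fixes \<mu> \<beta> :: "nat \<Rightarrow> real"
  assumes asc: "\<And>i j. i \<le> j \<Longrightarrow> j < n \<Longrightarrow> \<mu> i \<le> \<mu> j"
    and desc: "\<And>i j. i \<le> j \<Longrightarrow> j < n \<Longrightarrow> \<beta> j \<le> \<beta> i"
    and "i < n" "j < n"
  defines "u \<equiv> \<lambda>j. \<Sum>k<j. (\<mu> (Suc k) - \<mu> k) * \<beta> k"
  shows "u j - u i \<le> (\<mu> j - \<mu> i) * \<beta> i"
proof (cases "i \<le> j")
  case True
  thus ?thesis using \<open>j < n\<close>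
  proof (induction j rule: dec_induct)
    case (step j)
    have "(\<mu> (Suc j) - \<mu> j) * \<beta> j \<le> (\<mu> (Suc j) - \<mu> j) * \<beta> i"
      using asc[of j "Suc j"] desc[of i j] step by (intro mult_left_mono) auto
    thus ?case using step by (simp add: u_def algebra_simps)
  qed simp
next
  case False
  hence "j \<le> i" by simp
  thus ?thesis
  proof (induction j rule: inc_induct)
    case (step j)
    have "(\<mu> (Suc j) - \<mu> j) * \<beta> i \<le> (\<mu> (Suc j) - \<mu> j) * \<beta> j"
      using asc[of j "Suc j"] desc[of j i] step \<open>i < n\<close> by (intro mult_left_mono) auto
    thus ?case using step by (simp add: u_def algebra_simps)
  qed simp
qed

text \<open>
  Weak duality: row and column sums 1 turn the dual solution of \<open>opposite_order_potential\<close> into a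
  lower bound, and its value is the sum over the diagonal.
\<close>

lemma doubly_stochastic_rearrangement:
  fixes \<mu> \<beta> :: "nat \<Rightarrow> real"
  assumes asc: "\<And>i j. i \<le> j \<Longrightarrow> j < n \<Longrightarrow> \<mu> i \<le> \<mu> j"
    and desc: "\<And>i j. i \<le> j \<Longrightarrow> j < n \<Longrightarrow> \<beta> j \<le> \<beta> i"
    and P: "doubly_stochastic n P"
  shows "(\<Sum>i<n. \<beta> i * \<mu> i) \<le> (\<Sum>i<n. \<Sum>j<n. \<beta> i * \<mu> j * P i j)"
proof -
  define u where "u j = (\<Sum>k<j. (\<mu> (Suc k) - \<mu> k) * \<beta> k)" for j
  define v where "v i = \<beta> i * \<mu> i - u i" for i
  have "(\<Sum>i<n. \<beta> i * \<mu> i) = (\<Sum>i<n. v i) + (\<Sum>j<n. u j)"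
    by (simp add: v_def sum_subtractf)
  also have "(\<Sum>i<n. v i) = (\<Sum>i<n. \<Sum>j<n. v i * P i j)"
    using P by (simp add: doubly_stochastic_def flip: sum_distrib_left)
  also have "(\<Sum>j<n. u j) = (\<Sum>i<n. \<Sum>j<n. u j * P i j)"
    using P by (subst sum.swap) (simp add: doubly_stochastic_def flip: sum_distrib_left)
  also have "(\<Sum>i<n. \<Sum>j<n. v i * P i j) + (\<Sum>i<n. \<Sum>j<n. u j * P i j) =
      (\<Sum>i<n. \<Sum>j<n. (v i + u j) * P i j)"
    by (simp add: sum.distrib distrib_right)
  also have "\<dots> \<le> (\<Sum>i<n. \<Sum>j<n. \<beta> i * \<mu> j * P i j)"
  proof (intro sum_mono mult_right_mono)
    fix i j assume "i \<in> {..<n}" "j \<in> {..<n}"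
    thus "v i + u j \<le> \<beta> i * \<mu> j"
      using opposite_order_potential[of n \<mu> \<beta> i j] asc desc
      by (simp add: u_def v_def algebra_simps)
    show "0 \<le> P i j" using P \<open>i \<in> _\<close> \<open>j \<in> _\<close> by (simp add: doubly_stochastic_def)
  qed
  finally show ?thesis .
qed

text \<open>
  Averaging both sequences by doubly stochastic matrices \<open>P\<close> and \<open>Q\<close> amounts to pairing the
  original ones through the doubly stochastic matrix \<open>Q\<^sup>T P\<close>.
\<close>

lemma doubly_stochastic_pairing:
  fixes \<mu> \<beta> :: "nat \<Rightarrow> real"
  assumes asc: "\<And>i j. i \<le> j \<Longrightarrow> j < n \<Longrightarrow> \<mu> i \<le> \<mu> j"
    and desc: "\<And>i j. i \<le> j \<Longrightarrow> j < n \<Longrightarrow> \<beta> j \<le> \<beta> i"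
    and P: "doubly_stochastic n P" and Q: "doubly_stochastic n Q"
  shows "(\<Sum>i<n. \<beta> i * \<mu> i) \<le> (\<Sum>k<n. (\<Sum>j<n. \<mu> j * P k j) * (\<Sum>i<n. \<beta> i * Q k i))"
proof -
  have "(\<Sum>i<n. \<beta> i * \<mu> i) \<le> (\<Sum>i<n. \<Sum>j<n. \<beta> i * \<mu> j * (\<Sum>k<n. Q k i * P k j))"
    by (rule doubly_stochastic_rearrangement[OF asc desc
          doubly_stochastic_mult[OF doubly_stochastic_transpose[OF Q] P]])
  also have "\<dots> = (\<Sum>i<n. \<Sum>j<n. \<Sum>k<n. (\<mu> j * P k j) * (\<beta> i * Q k i))"
    by (simp add: sum_distrib_left mult_ac)
  also have "\<dots> = (\<Sum>i<n. \<Sum>k<n. \<Sum>j<n. (\<mu> j * P k j) * (\<beta> i * Q k i))"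
    by (intro sum.cong refl sum.swap)
  also have "\<dots> = (\<Sum>k<n. \<Sum>i<n. \<Sum>j<n. (\<mu> j * P k j) * (\<beta> i * Q k i))"
    by (rule sum.swap)
  also have "\<dots> = (\<Sum>k<n. (\<Sum>j<n. \<mu> j * P k j) * (\<Sum>i<n. \<beta> i * Q k i))"
    by (simp add: sum_distrib_right sum_distrib_left)
  finally show ?thesis .
qed

text \<open>
  If the averaged sequences \<open>d\<close> and \<open>e\<close> attain the lower bound, they must be oppositely ordered:
  exchanging two entries of \<open>d\<close> (two rows of \<open>P\<close>) gives another admissible pairing, which cannot
  be smaller.
\<close>

lemma minimal_pairing_opposite_order:
  fixes \<mu> \<beta> :: "nat \<Rightarrow> real"
  assumes asc: "\<And>i j. i \<le> j \<Longrightarrow> j < n \<Longrightarrow> \<mu> i \<le> \<mu> j"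
    and desc: "\<And>i j. i \<le> j \<Longrightarrow> j < n \<Longrightarrow> \<beta> j \<le> \<beta> i"
    and P: "doubly_stochastic n P" and Q: "doubly_stochastic n Q"
    and d: "\<And>k. k < n \<Longrightarrow> d k = (\<Sum>j<n. \<mu> j * P k j)"
    and e: "\<And>k. k < n \<Longrightarrow> e k = (\<Sum>i<n. \<beta> i * Q k i)"
    and minimal: "(\<Sum>k<n. d k * e k) \<le> (\<Sum>i<n. \<beta> i * \<mu> i)"
    and ab: "a < n" "b < n"
  shows "(d a - d b) * (e a - e b) \<le> 0"
proof (cases "a = b")
  case False
  define \<tau> where "\<tau> = Transposition.transpose a b"
  have \<tau>: "\<tau> permutes {..<n}" unfolding \<tau>_def using ab by (intro permutes_swap_id) auto
  have \<tau>_less: "\<tau> k < n" if "k < n" for k using permutes_in_image[OF \<tau>, of k] that by simp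
  have "(\<Sum>k<n. d k * e k) \<le> (\<Sum>k<n. (\<Sum>j<n. \<mu> j * P (\<tau> k) j) * (\<Sum>i<n. \<beta> i * Q k i))"
    by (rule order.trans[OF minimal], rule doubly_stochastic_pairing[OF asc desc
          doubly_stochastic_permute_rows[OF P \<tau>] Q])
  also have "\<dots> = (\<Sum>k<n. d (\<tau> k) * e k)"
    by (intro sum.cong refl) (simp add: d e \<tau>_less)
  finally have "0 \<le> (\<Sum>k<n. (d (\<tau> k) - d k) * e k)"
    by (simp add: sum_subtractf left_diff_distrib)
  also have "\<dots> = (\<Sum>k\<in>{a, b}. (d (\<tau> k) - d k) * e k)"
    by (intro sum.mono_neutral_right) (use ab in \<open>auto simp: \<tau>_def transpose_def\<close>)
  also have "\<dots> = - ((d a - d b) * (e a - e b))"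
    using False by (simp add: \<tau>_def algebra_simps)
  finally show ?thesis by simp
qed simp

lemma mat_trace_mult:
  assumes "A \<in> carrier_mat n m" "B \<in> carrier_mat m n"
  shows "mat_trace (A * B) = (\<Sum>i<n. \<Sum>j<m. A $$ (i, j) * B $$ (j, i))"
  using assms by (auto simp: mat_trace_def scalar_prod_def atLeast0LessThan intro!: sum.cong)

lemma mat_trace_commute:
  assumes "A \<in> carrier_mat n m" "B \<in> carrier_mat m n"
  shows "mat_trace (A * B) = mat_trace (B * A)"
  unfolding mat_trace_mult[OF assms] mat_trace_mult[OF assms(2,1)]
  by (subst sum.swap) (simp add: mult.commute)

lemma unitary_conj_diag_entry:
  assumes "Q \<in> carrier_mat n n" "i < n"
  shows "(Q * real_diag n d * mat_adjoint Q) $$ (i, i) = of_real (\<Sum>j<n. d j * (cmod (Q $$ (i, j)))\<^sup>2)"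
proof -
  have "(Q * real_diag n d * mat_adjoint Q) $$ (i, i) =
      (\<Sum>j<n. of_real (d j) * (Q $$ (i, j) * cnj (Q $$ (i, j))))"
    using assms by (simp add: mat_diag_mult_right[of _ n] scalar_prod_def atLeast0LessThan mult_ac)
  also have "\<dots> = of_real (\<Sum>j<n. d j * (cmod (Q $$ (i, j)))\<^sup>2)"
    by (simp only: of_real_sum of_real_mult complex_norm_square)
  finally show ?thesis .
qed

text \<open>
  Cyclicity of the trace moves both diagonalizations into the single unitary \<open>Q = W\<^sup>* U\<close>.
\<close>

lemma trace_formula:
  assumes W: "W \<in> unitaries n" and U: "U \<in> unitaries n"
  shows "mat_trace ((W * real_diag n b * mat_adjoint W) * (U * real_diag n m * mat_adjoint U)) =
    of_real (\<Sum>i<n. \<Sum>j<n. b i * m j * (cmod ((mat_adjoint W * U) $$ (i, j)))\<^sup>2)"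
proof -
  note Uc = unitaries_carrier[OF U] and Wc = unitaries_carrier[OF W]
  define Q where "Q = mat_adjoint W * U"
  have Q: "Q \<in> carrier_mat n n" using Uc Wc by (simp add: Q_def square_simps[where n=n])
  have "mat_trace ((W * real_diag n b * mat_adjoint W) * (U * real_diag n m * mat_adjoint U)) =
      mat_trace (W * (real_diag n b * mat_adjoint W * (U * real_diag n m * mat_adjoint U)))"
    using Uc Wc by (simp add: square_simps[where n=n])
  also have "\<dots> = mat_trace (real_diag n b * mat_adjoint W * (U * real_diag n m * mat_adjoint U) * W)"
    by (rule mat_trace_commute[of _ n n]) (use Uc Wc in \<open>auto simp: square_simps[where n=n]\<close>)
  also have "\<dots> = mat_trace (real_diag n b * (Q * real_diag n m * mat_adjoint Q))"
    using Uc Wc by (simp add: Q_def square_simps[where n=n])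
  also have "\<dots> = (\<Sum>i<n. of_real (b i) * (Q * real_diag n m * mat_adjoint Q) $$ (i, i))"
    using Q by (simp add: mat_trace_def mat_diag_mult_left[of _ n n] square_simps[where n=n]
        del: index_mult_mat(1))
  also have "\<dots> = of_real (\<Sum>i<n. \<Sum>j<n. b i * m j * (cmod (Q $$ (i, j)))\<^sup>2)"
    using Q by (simp add: unitary_conj_diag_entry sum_distrib_left mult_ac
        del: index_mult_mat(1))
  finally show ?thesis by (simp add: Q_def)
qed

theorem trace_inequality:
  fixes \<mu> \<beta> :: "nat \<Rightarrow> real"
  assumes asc: "\<And>i j. i \<le> j \<Longrightarrow> j < n \<Longrightarrow> \<mu> i \<le> \<mu> j"
    and desc: "\<And>i j. i \<le> j \<Longrightarrow> j < n \<Longrightarrow> \<beta> j \<le> \<beta> i"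
    and W: "W \<in> unitaries n" and U: "U \<in> unitaries n"
  shows "(\<Sum>i<n. \<beta> i * \<mu> i) \<le>
    Re (mat_trace ((W * real_diag n \<beta> * mat_adjoint W) * (U * real_diag n \<mu> * mat_adjoint U)))"
  unfolding trace_formula[OF W U]
  using doubly_stochastic_rearrangement[OF asc desc
      unitary_doubly_stochastic[OF mult_unitary[OF adjoint_unitary[OF W] U]]] by simp

text \<open>
  Let \<open>U\<close> diagonalize \<open>D - B\<close> with increasing eigenvalues. In this basis \<open>B\<close> and \<open>D\<close> have the same
  off-diagonal entries, so \<open>tr (B D)\<close> is the pairing of the diagonals \<open>e\<close> and \<open>d\<close> plus the squared
  moduli of these entries. The diagonals are doubly stochastic averages of the spectra, so their
  pairing alone already reaches \<open>\<Sum> \<beta> i * \<mu> i\<close>. Equality therefore kills the off-diagonal part and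
  makes \<open>d\<close> and \<open>e\<close> oppositely ordered. As \<open>d - e\<close> is increasing, \<open>d\<close> is increasing and \<open>e\<close>
  decreasing, so they are the ordered spectra themselves. Working with \<open>D - B\<close> takes care of
  repeated eigenvalues, which the eigenspaces of \<open>D\<close> alone would not.
\<close>

theorem trace_equality_simultaneous:
  fixes \<mu> \<beta> :: "nat \<Rightarrow> real"
  assumes asc: "\<And>i j. i \<le> j \<Longrightarrow> j < n \<Longrightarrow> \<mu> i \<le> \<mu> j"
    and desc: "\<And>i j. i \<le> j \<Longrightarrow> j < n \<Longrightarrow> \<beta> j \<le> \<beta> i"
    and W: "W \<in> unitaries n" "B = W * real_diag n \<beta> * mat_adjoint W"
    and V: "V \<in> unitaries n" "D = V * real_diag n \<mu> * mat_adjoint V"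
    and eq: "Re (mat_trace (B * D)) \<le> (\<Sum>i<n. \<beta> i * \<mu> i)"
  obtains U where "U \<in> unitaries n" "B = U * real_diag n \<beta> * mat_adjoint U"
    "D = U * real_diag n \<mu> * mat_adjoint U"
proof -
  note Wc = unitaries_carrier[OF W(1)] and Vc = unitaries_carrier[OF V(1)]
  have Bc: "B \<in> carrier_mat n n" and Dc: "D \<in> carrier_mat n n"
    using W V Wc Vc by (auto simp: square_simps[where n=n])
  have Bh: "mat_adjoint B = B" and Dh: "mat_adjoint D = D"
    unfolding W(2) V(2) using Wc Vc by (simp_all add: square_simps[where n=n])
  define m where "m i = eig (D - B) (n - i)" for i
  have M: "D - B \<in> carrier_mat n n" "mat_adjoint (D - B) = D - B"
    using Bc Dc Bh Dh by (auto simp: mat_adjoint_diff[of _ n n])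
  obtain U where U: "U \<in> unitaries n" "D - B = U * real_diag n m * mat_adjoint U"
    using diagonalize_ascending[OF M] unfolding m_def by blast
  note Uc = unitaries_carrier[OF U(1)]
  have m_asc: "m i \<le> m j" if "i \<le> j" "j < n" for i j
    using eig_antimono[OF M, of "n - Suc j" "n - Suc i"] that by (simp add: m_def Suc_diff_Suc)
  define D' where "D' = mat_adjoint U * D * U"
  define B' where "B' = mat_adjoint U * B * U"
  have D'c: "D' \<in> carrier_mat n n" and B'c: "B' \<in> carrier_mat n n"
    using Uc Bc Dc by (auto simp: D'_def B'_def square_simps[where n=n])
  have D_D': "D = U * D' * mat_adjoint U" and B_B': "B = U * B' * mat_adjoint U"
    unfolding D'_def B'_def using unitary_conj_cancel(1)[OF U(1)] Bc Dc by simp_all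
  have D'h: "mat_adjoint D' = D'"
    using Uc Dc Dh by (simp add: D'_def square_simps[where n=n])
  have "D' - B' = mat_adjoint U * (D - B) * U"
    using Uc Bc Dc by (simp add: D'_def B'_def mult_minus_distrib_mat[of _ n n _ n]
        minus_mult_distrib_mat[of _ n n _ _ n] square_simps[where n=n])
  also have "\<dots> = real_diag n m" unfolding U(2) by (rule unitary_conj_cancel(2)[OF U(1)]) simp
  finally have diff: "D' - B' = real_diag n m" .
  have diff_entry: "D' $$ (i, j) - B' $$ (i, j) = (if i = j then of_real (m i) else 0)"
    if "i < n" "j < n" for i j
    using arg_cong[OF diff, of "\<lambda>X. X $$ (i, j)"] that D'c B'c by (simp add: mat_diag_def)
  define d where "d i = (\<Sum>j<n. \<mu> j * (cmod ((mat_adjoint U * V) $$ (i, j)))\<^sup>2)" for i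
  define e where "e i = (\<Sum>j<n. \<beta> j * (cmod ((mat_adjoint U * W) $$ (i, j)))\<^sup>2)" for i
  have D'_diag: "D' $$ (i, i) = of_real (d i)" if "i < n" for i
  proof -
    have "D' = (mat_adjoint U * V) * real_diag n \<mu> * mat_adjoint (mat_adjoint U * V)"
      using Uc Vc by (simp add: D'_def V(2) square_simps[where n=n])
    thus ?thesis using unitary_conj_diag_entry[of "mat_adjoint U * V" n i \<mu>] that Uc Vc
      by (simp add: d_def mult_carrier_mat[of _ n n _ n] del: index_mult_mat(1))
  qed
  have B'_diag: "B' $$ (i, i) = of_real (e i)" if "i < n" for i
  proof -
    have "B' = (mat_adjoint U * W) * real_diag n \<beta> * mat_adjoint (mat_adjoint U * W)"
      using Uc Wc by (simp add: B'_def W(2) square_simps[where n=n])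
    thus ?thesis using unitary_conj_diag_entry[of "mat_adjoint U * W" n i \<beta>] that Uc Wc
      by (simp add: e_def mult_carrier_mat[of _ n n _ n] del: index_mult_mat(1))
  qed
  have m_eq: "m i = d i - e i" if "i < n" for i
    using diff_entry[of i i] that by (simp add: D'_diag B'_diag flip: of_real_diff)
  define off where "off i j = (if i = j then 0 else (cmod (D' $$ (i, j)))\<^sup>2)" for i j
  have entry: "Re (B' $$ (i, j) * D' $$ (j, i)) = (if i = j then d i * e i else 0) + off i j"
    if "i < n" "j < n" for i j
  proof (cases "i = j")
    case False
    have "D' $$ (j, i) = cnj (D' $$ (i, j))"
      using arg_cong[OF D'h, of "\<lambda>X. X $$ (j, i)"] that D'c by simp
    moreover have "B' $$ (i, j) = D' $$ (i, j)" using diff_entry[OF that] False by simp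
    ultimately show ?thesis
      using False by (simp add: off_def flip: complex_norm_square of_real_power)
  qed (use that in \<open>simp add: off_def D'_diag B'_diag\<close>)
  have "mat_trace (B * D) = mat_trace (U * (B' * D' * mat_adjoint U))"
    unfolding B_B' D_D' using Uc B'c D'c
    by (simp add: square_simps[where n=n] unitary_cancel[OF U(1), of _ n])
  also have "\<dots> = mat_trace (B' * D' * mat_adjoint U * U)"
    by (rule mat_trace_commute[of _ n n]) (use Uc B'c D'c in \<open>auto simp: square_simps[where n=n]\<close>)
  also have "\<dots> = mat_trace (B' * D')"
    using Uc B'c D'c by (simp add: square_simps[where n=n] unitaries_left[OF U(1)]
        right_mult_one_mat[of _ n n])
  finally have "Re (mat_trace (B * D)) = (\<Sum>i<n. \<Sum>j<n. Re (B' $$ (i, j) * D' $$ (j, i)))"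
    by (simp add: mat_trace_mult[OF B'c D'c])
  also have "\<dots> = (\<Sum>i<n. \<Sum>j<n. (if i = j then d i * e i else 0) + off i j)"
    by (intro sum.cong refl entry) auto
  also have "\<dots> = (\<Sum>i<n. d i * e i) + (\<Sum>i<n. \<Sum>j<n. off i j)"
    by (simp add: sum.distrib)
  finally have trace: "Re (mat_trace (B * D)) = (\<Sum>i<n. d i * e i) + (\<Sum>i<n. \<Sum>j<n. off i j)" .
  have P: "doubly_stochastic n (\<lambda>i j. (cmod ((mat_adjoint U * V) $$ (i, j)))\<^sup>2)"
    and Q: "doubly_stochastic n (\<lambda>i j. (cmod ((mat_adjoint U * W) $$ (i, j)))\<^sup>2)"
    by (intro unitary_doubly_stochastic mult_unitary adjoint_unitary U(1) V(1) W(1))+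
  have "(\<Sum>i<n. \<beta> i * \<mu> i) \<le> (\<Sum>i<n. d i * e i)"
    unfolding d_def e_def by (rule doubly_stochastic_pairing[OF asc desc P Q])
  hence "(\<Sum>i<n. \<Sum>j<n. off i j) \<le> 0" using trace eq by simp
  moreover have off_nonneg: "off i j \<ge> 0" for i j by (simp add: off_def)
  ultimately have "(\<Sum>i<n. \<Sum>j<n. off i j) = 0" by (meson antisym sum_nonneg)
  hence off0: "off i j = 0" if "i < n" "j < n" for i j
    using that off_nonneg by (simp add: sum_nonneg_eq_0_iff sum_nonneg)
  have D'_off: "D' $$ (i, j) = 0" if "i < n" "j < n" "i \<noteq> j" for i j
    using off0[OF that(1,2)] that(3) by (simp add: off_def)
  have D'_eq: "D' = real_diag n d"
    by (rule eq_matI) (use D'c D'_diag D'_off in \<open>auto simp: mat_diag_def\<close>)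
  have B'_eq: "B' = real_diag n e"
  proof (rule eq_matI)
    fix i j assume "i < dim_row (real_diag n e)" "j < dim_col (real_diag n e)"
    hence ij: "i < n" "j < n" by (auto simp: mat_diag_def)
    show "B' $$ (i, j) = real_diag n e $$ (i, j)"
      using diff_entry[OF ij] D'_off[OF ij] B'_diag ij
      by (cases "i = j") (auto simp: mat_diag_def)
  qed (use B'c in \<open>auto simp: mat_diag_def\<close>)
  have opp: "(d a - d b) * (e a - e b) \<le> 0" if "a < n" "b < n" for a b
  proof (rule minimal_pairing_opposite_order[OF asc desc P Q _ _ _ that])
    show "(\<Sum>k<n. d k * e k) \<le> (\<Sum>i<n. \<beta> i * \<mu> i)"
      using trace eq \<open>(\<Sum>i<n. \<Sum>j<n. off i j) = 0\<close> by simp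
  qed (simp_all add: d_def e_def)
  have d_asc: "d i \<le> d j" and e_desc: "e j \<le> e i" if "i \<le> j" "j < n" for i j
  proof -
    have m: "d i - e i \<le> d j - e j" using m_asc[OF that] m_eq[of i] m_eq[of j] that by simp
    show "d i \<le> d j"
    proof (rule ccontr)
      assume "\<not> d i \<le> d j"
      hence "(d i - d j) * (e i - e j) > 0" using m by (intro mult_pos_pos) auto
      thus False using opp[of i j] that by simp
    qed
    show "e j \<le> e i"
    proof (rule ccontr)
      assume "\<not> e j \<le> e i"
      hence "(d i - d j) * (e i - e j) > 0" using m by (intro mult_neg_neg) auto
      thus False using opp[of i j] that by simp
    qed
  qed
  have D_eq: "D = U * real_diag n d * mat_adjoint U" and B_eq: "B = U * real_diag n e * mat_adjoint U"
    using D_D' B_B' D'_eq B'_eq by simp_all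
  have "d i = \<mu> i" if "i < n" for i
    using eig_ascending[OF U(1) D_eq d_asc that] eig_ascending[OF V asc that] by simp
  hence "real_diag n d = real_diag n \<mu>" by (intro eq_matI) (auto simp: mat_diag_def)
  moreover have "e i = \<beta> i" if "i < n" for i
    using eig_descending[OF U(1) B_eq e_desc that] eig_descending[OF W desc that] by simp
  hence "real_diag n e = real_diag n \<beta>" by (intro eq_matI) (auto simp: mat_diag_def)
  ultimately show thesis using that[OF U(1)] D_eq B_eq by metis
qed

section \<open>Singular value decomposition\<close>

lemma descending_indicators_eq:
  fixes f g :: "nat \<Rightarrow> real"
  assumes f: "\<And>i. i < n \<Longrightarrow> f i = 0 \<or> f i = 1" "\<And>i j. i \<le> j \<Longrightarrow> j < n \<Longrightarrow> f j \<le> f i"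
    and g: "\<And>i. i < n \<Longrightarrow> g i = 0 \<or> g i = 1" "\<And>i j. i \<le> j \<Longrightarrow> j < n \<Longrightarrow> g j \<le> g i"
    and eq: "(\<Sum>i<n. f i) = (\<Sum>i<n. g i)" and "i < n"
  shows "f i = g i"
proof -
  have *: False if f: "\<And>i. i < n \<Longrightarrow> f i = 0 \<or> f i = 1" "\<And>i j. i \<le> j \<Longrightarrow> j < n \<Longrightarrow> f j \<le> f i"
    and g: "\<And>i. i < n \<Longrightarrow> g i = 0 \<or> g i = 1" "\<And>i j. i \<le> j \<Longrightarrow> j < n \<Longrightarrow> g j \<le> g i"
    and eq: "(\<Sum>i<n. f i) = (\<Sum>i<n. g i)" and less: "g i < f i" for f g :: "nat \<Rightarrow> real"
  proof -
    have i: "f i = 1" "g i = 0" using f(1)[OF \<open>i < n\<close>] g(1)[OF \<open>i < n\<close>] less by auto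
    have "g k \<le> f k" if "k < n" for k
    proof (cases "k \<le> i")
      case True
      thus ?thesis using f(2)[OF True \<open>i < n\<close>] g(1)[OF that] i by auto
    next
      case False
      thus ?thesis using g(2)[of i k] f(1)[OF that] that i by auto
    qed
    hence "(\<Sum>i<n. g i) < (\<Sum>i<n. f i)"
      using less \<open>i < n\<close> by (intro sum_strict_mono_ex1) auto
    thus False using eq by simp
  qed
  show ?thesis
  proof (rule linorder_cases[of "f i" "g i"])
    assume "f i < g i"
    thus ?thesis using *[OF g f eq[symmetric]] by blast
  next
    assume "g i < f i"
    thus ?thesis using *[OF f g eq] by blast
  qed
qed

lemma mat_diag_cong: "(\<And>i. i < n \<Longrightarrow> f i = g i) \<Longrightarrow> mat_diag n f = mat_diag n g"
  by (intro eq_matI) (auto simp: mat_diag_def)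

lemma mat_diag_zero: "mat_diag n (\<lambda>_. 0 :: complex) = 0\<^sub>m n n"
  by (intro eq_matI) (auto simp: mat_diag_def)

lemma mat_diag_add: "mat_diag n f + mat_diag n g = mat_diag n (\<lambda>i. f i + g i :: complex)"
  by (intro eq_matI) (auto simp: mat_diag_def)

text \<open>
  \<open>C\<close> is a partial isometry whose nonzero columns come first. The projection \<open>C C\<^sup>*\<close> onto its range
  has the same trace as \<open>C\<^sup>* C\<close>, hence, being diagonalizable with decreasing 0-1 diagonal, the same
  diagonal \<open>f\<close>. Its remaining eigenvectors span the orthogonal complement of the range, and they
  replace the zero columns of \<open>C\<close>.
\<close>

lemma complete_partial_isometry:
  assumes C: "C \<in> carrier_mat n n" and E: "mat_adjoint C * C = real_diag n f"
    and f: "\<And>i. i < n \<Longrightarrow> f i = 0 \<or> f i = 1" "\<And>i j. i \<le> j \<Longrightarrow> j < n \<Longrightarrow> f j \<le> f i"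
    and CE: "C * real_diag n f = C"
  obtains V where "V \<in> unitaries n" "V * real_diag n f = C"
proof -
  define P where "P = C * mat_adjoint C"
  have P: "P \<in> carrier_mat n n" "mat_adjoint P = P"
    using C by (auto simp: P_def square_simps[where n=n])
  have "P * P = C * (mat_adjoint C * C) * mat_adjoint C"
    using C by (simp add: P_def square_simps[where n=n])
  also have "\<dots> = P" unfolding E CE P_def ..
  finally have idem: "P * P = P" .
  define g where "g i = eig P (Suc i)" for i
  obtain W where W: "W \<in> unitaries n" "P = W * real_diag n g * mat_adjoint W"
    using diagonalize_descending[OF P] unfolding g_def by blast
  note Wc = unitaries_carrier[OF W(1)]
  have g_diag: "real_diag n g = mat_adjoint W * P * W"
    unfolding W(2) by (rule unitary_conj_cancel(2)[OF W(1), symmetric]) simp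
  also have "\<dots> = (mat_adjoint W * P * W) * (mat_adjoint W * P * W)"
    using Wc P(1) idem assoc_mult_mat[OF P(1) P(1) Wc]
    by (simp add: square_simps[where n=n] unitary_cancel[OF W(1), of _ n])
  also have "\<dots> = real_diag n g * real_diag n g" unfolding g_diag ..
  finally have gg: "real_diag n g = real_diag n (\<lambda>i. g i * g i)" by simp
  have g01: "g i = 0 \<or> g i = 1" if "i < n" for i
  proof -
    have "complex_of_real (g i) = complex_of_real (g i * g i)"
      using arg_cong[OF gg, of "\<lambda>X. X $$ (i, i)"] that by (simp add: mat_diag_def)
    hence "g i = g i * g i" by (simp only: of_real_eq_iff)
    thus ?thesis by auto
  qed
  have g_desc: "g j \<le> g i" if "i \<le> j" "j < n" for i j
    unfolding g_def by (rule eig_antimono[OF P that])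
  have trace_diag: "mat_trace (real_diag n h) = of_real (\<Sum>i<n. h i)" for h
    by (simp add: mat_trace_def mat_diag_def)
  have "complex_of_real (\<Sum>i<n. g i) = mat_trace (real_diag n g)" by (simp add: trace_diag)
  also have "\<dots> = mat_trace (mat_adjoint W * (P * W))"
    unfolding g_diag using Wc P(1) by (simp add: square_simps[where n=n])
  also have "\<dots> = mat_trace (P * W * mat_adjoint W)"
    by (rule mat_trace_commute[of _ n n]) (use Wc P(1) in \<open>auto simp: square_simps[where n=n]\<close>)
  also have "\<dots> = mat_trace P"
    using Wc P(1) by (simp add: square_simps[where n=n] unitaries_right[OF W(1)]
        right_mult_one_mat[of _ n n])
  also have "\<dots> = mat_trace (mat_adjoint C * C)"
    unfolding P_def by (rule mat_trace_commute[of _ n n]) (use C in auto)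
  also have "\<dots> = complex_of_real (\<Sum>i<n. f i)" unfolding E by (rule trace_diag)
  finally have "(\<Sum>i<n. f i) = (\<Sum>i<n. g i)" by (simp only: of_real_eq_iff)
  hence "f i = g i" if "i < n" for i
    using descending_indicators_eq[of n f g i] f g01 g_desc that by blast
  hence gf: "real_diag n g = real_diag n f" by (intro eq_matI) (auto simp: mat_diag_def)
  define N where "N = real_diag n (\<lambda>i. 1 - f i)"
  have N: "N \<in> carrier_mat n n" "mat_adjoint N = N" by (auto simp: N_def)
  have fN: "real_diag n f * N = 0\<^sub>m n n" "N * real_diag n f = 0\<^sub>m n n"
    unfolding N_def mat_diag_diag mat_diag_zero[symmetric] by (auto intro!: mat_diag_cong dest!: f(1))
  have sumN: "real_diag n f + N * N = 1\<^sub>m n"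
    unfolding N_def mat_diag_diag mat_diag_add
    by (rule trans[OF mat_diag_cong mat_diag_one]) (auto dest!: f(1))
  have fC: "real_diag n f * mat_adjoint C = mat_adjoint C"
    using arg_cong[OF CE, of mat_adjoint] C by (simp add: square_simps[where n=n])
  have "mat_adjoint C * (W * N) = mat_adjoint C * C * mat_adjoint C * (W * N)"
    unfolding E fC ..
  also have "\<dots> = mat_adjoint C * P * (W * N)"
    using C Wc N by (simp add: P_def square_simps[where n=n])
  also have "\<dots> = mat_adjoint C * (W * (real_diag n f * N))"
    unfolding W(2) gf using C Wc N
    by (simp add: square_simps[where n=n] unitary_cancel[OF W(1), of _ n])
  also have "\<dots> = 0\<^sub>m n n" unfolding fN using C Wc by simp
  finally have X: "mat_adjoint C * (W * N) = 0\<^sub>m n n" .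
  have X': "mat_adjoint (W * N) * C = 0\<^sub>m n n"
  proof -
    have "mat_adjoint (W * N) * C = mat_adjoint (mat_adjoint C * (W * N))"
      using C Wc N by (simp add: square_simps[where n=n])
    also have "\<dots> = 0\<^sub>m n n" unfolding X by (intro eq_matI) auto
    finally show ?thesis .
  qed
  have WN: "W * N \<in> carrier_mat n n" using Wc N by simp
  \<comment> \<open>The columns of \<open>W * N\<close> are the eigenvectors of \<open>P\<close> for the eigenvalue 0, padded by zeros.\<close>
  define V where "V = C + W * N"
  have Vc: "V \<in> carrier_mat n n" using C WN by (simp add: V_def)
  have "mat_adjoint V * V = (mat_adjoint C * C + mat_adjoint (W * N) * C) +
      (mat_adjoint C * (W * N) + mat_adjoint (W * N) * (W * N))"
    unfolding V_def mat_adjoint_add[OF C WN] using C WN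
    by (simp add: mult_add_distrib_mat[of _ n n _ n] add_mult_distrib_mat[of _ n n _ _ n])
  also have "\<dots> = real_diag n f + mat_adjoint (W * N) * (W * N)"
    unfolding X X' E using WN
    by (simp add: left_add_zero_mat[of _ n n] mult_carrier_mat[of _ n n _ n])
  also have "mat_adjoint (W * N) * (W * N) = N * N"
    using Wc N by (simp add: square_simps[where n=n] unitary_cancel[OF W(1), of _ n])
  finally have "V \<in> unitaries n" unfolding sumN using Vc by (intro unitariesI)
  moreover have "V * real_diag n f = C"
  proof -
    have "V * real_diag n f = C * real_diag n f + W * N * real_diag n f"
      unfolding V_def using C WN by (simp add: add_mult_distrib_mat[of _ n n _ _ n])
    also have "W * N * real_diag n f = W * (N * real_diag n f)"
      using Wc N by (simp add: square_simps[where n=n])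
    finally show ?thesis using CE C Wc by (simp add: fN)
  qed
  ultimately show thesis by (rule that)
qed

text \<open>
  The right unitary factor can be any unitary that diagonalizes \<open>A\<^sup>* A\<close> in decreasing order. This
  freedom is needed because the minimizers are described through unitaries that diagonalize another
  matrix. The columns of \<open>A U\<close> are orthogonal with lengths \<open>s i\<close>; dividing by the nonzero lengths
  gives a partial isometry, which extends to \<open>V\<close>.
\<close>

theorem singular_value_decomposition:
  assumes A: "A \<in> carrier_mat n n" and U: "U \<in> unitaries n"
    and gram: "mat_adjoint A * A = U * real_diag n (\<lambda>i. (s i)\<^sup>2) * mat_adjoint U"
    and s: "\<And>i. i < n \<Longrightarrow> 0 \<le> s i" "\<And>i j. i \<le> j \<Longrightarrow> j < n \<Longrightarrow> s j \<le> s i"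
  obtains V where "V \<in> unitaries n" "A = V * real_diag n s * mat_adjoint U"
proof -
  note Uc = unitaries_carrier[OF U]
  define C where "C = A * U"
  have C: "C \<in> carrier_mat n n" using A Uc by (simp add: C_def)
  have "mat_adjoint C * C = mat_adjoint U * (mat_adjoint A * A) * U"
    using A Uc by (simp add: C_def square_simps[where n=n])
  also have "\<dots> = real_diag n (\<lambda>i. (s i)\<^sup>2)"
    unfolding gram by (rule unitary_conj_cancel(2)[OF U]) simp
  finally have CC: "mat_adjoint C * C = real_diag n (\<lambda>i. (s i)\<^sup>2)" .
  define f where "f i = (if s i = 0 then 0 else 1 :: real)" for i
  \<comment> \<open>A pseudo-inverse of the diagonal factor, since \<open>inverse 0 = 0\<close>.\<close>
  define T where "T = real_diag n (\<lambda>i. inverse (s i))"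
  have T: "T \<in> carrier_mat n n" "mat_adjoint T = T" by (auto simp: T_def)
  have Tf: "T * real_diag n f = T" "T * real_diag n s = real_diag n f"
    unfolding T_def mat_diag_diag by (auto simp: f_def intro!: mat_diag_cong)
  have zero_col: "C $$ (k, i) = 0" if "k < n" "i < n" "s i = 0" for k i
  proof -
    have "complex_of_real (\<Sum>k<n. (cmod (C $$ (k, i)))\<^sup>2) = 0"
      using gram_diag_entry[OF C \<open>i < n\<close>] that by (simp add: CC mat_diag_def)
    hence "(\<Sum>k<n. (cmod (C $$ (k, i)))\<^sup>2) = 0" by (simp only: of_real_eq_0_iff)
    thus ?thesis using that by (simp add: sum_nonneg_eq_0_iff)
  qed
  have Cf: "C * real_diag n f = C"
    by (rule eq_matI) (use C zero_col in \<open>auto simp: mat_diag_mult_right[of _ n] f_def\<close>)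
  obtain V where V: "V \<in> unitaries n" "V * real_diag n f = C * T"
  proof (rule complete_partial_isometry[of "C * T" n f])
    show "C * T \<in> carrier_mat n n" using C T by simp
    have "mat_adjoint (C * T) * (C * T) = T * (mat_adjoint C * C) * T"
      using C T by (simp add: square_simps[where n=n])
    also have "\<dots> = real_diag n f"
      unfolding CC T_def mat_diag_diag by (auto simp: f_def power2_eq_square field_simps intro!: mat_diag_cong)
    finally show "mat_adjoint (C * T) * (C * T) = real_diag n f" .
    show "f i = 0 \<or> f i = 1" for i by (simp add: f_def)
    show "f j \<le> f i" if "i \<le> j" "j < n" for i j
      using s(2)[OF that] s(1)[of j] that by (auto simp: f_def)
    show "C * T * real_diag n f = C * T" using C T by (simp add: square_simps[where n=n] Tf)
  qed blast
  note Vc = unitaries_carrier[OF V(1)]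
  have fs: "real_diag n f * real_diag n s = real_diag n s"
    unfolding mat_diag_diag by (auto simp: f_def intro!: mat_diag_cong)
  have "V * real_diag n s = V * real_diag n f * real_diag n s"
    using Vc by (simp add: square_simps[where n=n] fs del: mat_diag_diag)
  also have "\<dots> = C" unfolding V(2) using C T Cf Tf(2) by (simp add: square_simps[where n=n])
  finally have "V * real_diag n s * mat_adjoint U = A"
    using A Uc by (simp add: C_def square_simps[where n=n] unitaries_right[OF U]
        right_mult_one_mat[of _ n n])
  thus thesis using that V(1) by metis
qed

section \<open>Minimizing a linear form under a power constraint\<close>

text \<open>
  Bernoulli's inequality for exponents below 1. Squaring the weak form at \<open>sqrt z\<close> bounds
  \<open>z powr q\<close> by a number that is smaller than the tangent by \<open>q * (1 - q) * (sqrt z - 1)\<^sup>2\<close>,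
  which gives strictness away from 1.
\<close>

lemma powr_below_tangent_at_1:
  fixes q z :: real
  assumes q: "0 < q" "q < 1" and z: "0 \<le> z"
  shows "z powr q \<le> 1 + q * (z - 1)" and "1 + q * (z - 1) \<le> z powr q \<Longrightarrow> z = 1"
proof -
  have weak: "u powr q \<le> 1 + q * (u - 1)" if "0 \<le> u" for u
    using Youngs_inequality_0[of q "1 - q" u 1] q that
    by (cases "u = 0") (auto simp: algebra_simps)
  show "z powr q \<le> 1 + q * (z - 1)" by (rule weak[OF z])
  assume tight: "1 + q * (z - 1) \<le> z powr q"
  define u where "u = sqrt z"
  have u: "0 \<le> u" "z = u\<^sup>2" using z by (auto simp: u_def)
  have "z powr q = (u powr q)\<^sup>2"
    using u by (cases "u = 0") (auto simp: power2_eq_square powr_mult)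
  also have "\<dots> \<le> (1 + q * (u - 1))\<^sup>2" by (intro power_mono weak u(1)) simp
  finally have "1 + q * (u\<^sup>2 - 1) \<le> (1 + q * (u - 1))\<^sup>2" using tight u(2) by simp
  hence "q * (1 - q) * (u - 1)\<^sup>2 \<le> 0" by (simp add: power2_eq_square algebra_simps)
  moreover have "q * (1 - q) > 0" using q by simp
  ultimately have "(u - 1)\<^sup>2 \<le> 0" by (meson mult_pos_pos not_le)
  thus "z = 1" using u by simp
qed

lemma powr_below_tangent:
  fixes q x y :: real
  assumes q: "0 < q" "q < 1" and x: "0 \<le> x" and y: "0 < y"
  shows "x powr q \<le> y powr q + q * y powr (q - 1) * (x - y)"
    and "y powr q + q * y powr (q - 1) * (x - y) \<le> x powr q \<Longrightarrow> x = y"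
proof -
  have z: "0 \<le> x / y" using x y by simp
  have x_eq: "x powr q = y powr q * (x / y) powr q"
    using x y by (simp flip: powr_mult)
  have rhs: "y powr q + q * y powr (q - 1) * (x - y) = y powr q * (1 + q * (x / y - 1))"
    using y by (simp add: powr_diff field_simps)
  show "x powr q \<le> y powr q + q * y powr (q - 1) * (x - y)"
    unfolding x_eq rhs using powr_below_tangent_at_1(1)[OF q z] by (intro mult_left_mono) auto
  assume "y powr q + q * y powr (q - 1) * (x - y) \<le> x powr q"
  hence "1 + q * (x / y - 1) \<le> (x / y) powr q" unfolding x_eq rhs using y by simp
  thus "x = y" using powr_below_tangent_at_1(2)[OF q z] y by simp
qed

text \<open>
  Hoelder's inequality with its equality case, in a form in which weights may vanish. The point
  \<open>y i = S powr (- 1 / q) * a i powr (1 / (1 - q))\<close> satisfies the constraint and the Lagrange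
  condition: all derivatives of \<open>a i * x powr q\<close> at \<open>y i\<close> with \<open>a i > 0\<close> have the same value \<open>K\<close>.
  Hence the tangents sum up to \<open>K\<close> times the difference of \<open>\<Sum> x i\<close> and \<open>\<Sum> y i\<close>.
\<close>

lemma weighted_powr_sum_minimum:
  fixes a x :: "'i \<Rightarrow> real" and q :: real
  assumes fin: "finite I" and q: "0 < q" "q < 1"
    and a: "\<And>i. i \<in> I \<Longrightarrow> 0 \<le> a i" and x: "\<And>i. i \<in> I \<Longrightarrow> 0 \<le> x i"
    and k: "k \<in> I" "0 < a k" and constr: "(\<Sum>i\<in>I. a i * x i powr q) = 1"
  defines "S \<equiv> \<Sum>i\<in>I. a i powr (1 / (1 - q))"
  shows "S powr ((q - 1) / q) \<le> (\<Sum>i\<in>I. x i)"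
    and "(\<Sum>i\<in>I. x i) \<le> S powr ((q - 1) / q) \<Longrightarrow> i \<in> I \<Longrightarrow>
      x i = S powr (- 1 / q) * a i powr (1 / (1 - q))"
proof -
  have S: "0 < S"
    unfolding S_def by (rule sum_pos2[OF fin k(1)]) (use k in auto)
  define y where "y i = S powr (- 1 / q) * a i powr (1 / (1 - q))" for i
  define K where "K = q * S powr ((1 - q) / q)"
  have K: "0 < K" using q S by (simp add: K_def)
  have y_pos: "0 < y i" if "i \<in> I" "0 < a i" for i using that S by (simp add: y_def)
  have slope: "a i * (q * y i powr (q - 1)) = K" if "i \<in> I" "0 < a i" for i
  proof -
    have "y i powr (q - 1) = S powr (- 1 / q * (q - 1)) * a i powr (1 / (1 - q) * (q - 1))"
      by (simp add: y_def powr_mult powr_powr)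
    also have "- 1 / q * (q - 1) = (1 - q) / q" using q by (simp add: field_simps)
    also have "1 / (1 - q) * (q - 1) = - 1" using q by (simp add: field_simps)
    finally show ?thesis using that by (simp add: K_def powr_minus)
  qed
  have y_value: "a i * y i powr q = y i * (S powr ((1 - q) / q))" if "i \<in> I" for i
  proof (cases "a i = 0")
    case False
    hence ai: "0 < a i" using a that by (simp add: order_less_le)
    have "a i * y i powr q = a i * (y i powr (q - 1)) * y i"
      using y_pos[OF that ai] by (simp add: powr_diff)
    also have "a i * (y i powr (q - 1)) = S powr ((1 - q) / q)"
      using slope[OF that ai] q by (simp add: K_def)
    finally show ?thesis by simp
  qed (use q in \<open>simp add: y_def\<close>)
  have sum_y: "(\<Sum>i\<in>I. y i) = S powr ((q - 1) / q)"
  proof -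
    have "(\<Sum>i\<in>I. y i) = S powr (- 1 / q) * S powr 1"
      using S by (simp add: y_def S_def sum_distrib_left)
    also have "\<dots> = S powr (- 1 / q + 1)" by (simp only: powr_add)
    also have "- 1 / q + 1 = (q - 1) / q" using q by (simp add: field_simps)
    finally show ?thesis .
  qed
  have constr_y: "(\<Sum>i\<in>I. a i * y i powr q) = 1"
  proof -
    have "(\<Sum>i\<in>I. a i * y i powr q) = (\<Sum>i\<in>I. y i) * S powr ((1 - q) / q)"
      by (simp add: y_value sum_distrib_right)
    also have "\<dots> = S powr ((q - 1) / q + (1 - q) / q)" unfolding sum_y powr_add ..
    also have "(q - 1) / q + (1 - q) / q = 0" by (simp flip: add_divide_distrib)
    finally show ?thesis using S by simp
  qed
  have tangent: "a i * x i powr q \<le> a i * y i powr q + K * (x i - y i)"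
    and tangent_eq: "a i * y i powr q + K * (x i - y i) \<le> a i * x i powr q \<Longrightarrow> x i = y i"
    if i: "i \<in> I" for i
  proof -
    consider "a i = 0" | "0 < a i" using a[OF i] by fastforce
    hence "a i * x i powr q \<le> a i * y i powr q + K * (x i - y i) \<and>
      (a i * y i powr q + K * (x i - y i) \<le> a i * x i powr q \<longrightarrow> x i = y i)"
    proof cases
      \<comment> \<open>A zero weight contributes nothing to the constraint, and \<open>K > 0\<close> forces \<open>x i = 0\<close> in the case of equality.\<close>
      case 1
      hence "y i = 0" using q by (simp add: y_def)
      thus ?thesis using 1 x[OF i] K by (auto simp: mult_le_0_iff)
    next
      case 2
      have rhs: "a i * y i powr q + K * (x i - y i) =
          a i * (y i powr q + q * y i powr (q - 1) * (x i - y i))"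
        unfolding slope[OF i 2, symmetric] by (simp add: algebra_simps)
      note tan = powr_below_tangent[OF q x[OF i] y_pos[OF i 2]]
      show ?thesis unfolding rhs using tan 2 by auto
    qed
    thus "a i * x i powr q \<le> a i * y i powr q + K * (x i - y i)"
      "a i * y i powr q + K * (x i - y i) \<le> a i * x i powr q \<Longrightarrow> x i = y i" by auto
  qed
  have gap: "(\<Sum>i\<in>I. a i * y i powr q + K * (x i - y i) - a i * x i powr q) =
      K * ((\<Sum>i\<in>I. x i) - S powr ((q - 1) / q))"
    by (simp add: sum.distrib sum_subtractf constr constr_y sum_y[symmetric]
        flip: sum_distrib_left)
  have gap_nonneg: "0 \<le> a i * y i powr q + K * (x i - y i) - a i * x i powr q" if "i \<in> I" for i
    using tangent[OF that] by simp
  hence "0 \<le> K * ((\<Sum>i\<in>I. x i) - S powr ((q - 1) / q))"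
    unfolding gap[symmetric] by (intro sum_nonneg)
  thus lower: "S powr ((q - 1) / q) \<le> (\<Sum>i\<in>I. x i)"
    using K by (simp add: zero_le_mult_iff)
  assume "(\<Sum>i\<in>I. x i) \<le> S powr ((q - 1) / q)" "i \<in> I"
  hence "(\<Sum>i\<in>I. a i * y i powr q + K * (x i - y i) - a i * x i powr q) = 0"
    using lower gap by simp
  hence "a i * y i powr q + K * (x i - y i) - a i * x i powr q = 0"
    using gap_nonneg \<open>i \<in> I\<close> fin by (simp add: sum_nonneg_eq_0_iff)
  hence "x i = y i" using tangent_eq[OF \<open>i \<in> I\<close>] by simp
  thus "x i = S powr (- 1 / q) * a i powr (1 / (1 - q))" unfolding y_def .
qed

text \<open>
  With \<open>Q\<close> the sum of squares, each \<open>s i\<close> is at most \<open>sqrt Q\<close>, so \<open>s i powr p\<close> is at most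
  \<open>(s i)\<^sup>2 * Q powr ((p - 2) / 2)\<close>.
\<close>

lemma square_sum_lower_bound:
  fixes \<tau> s :: "'i \<Rightarrow> real"
  assumes fin: "finite I" and p: "2 \<le> p"
    and \<tau>: "\<And>i. i \<in> I \<Longrightarrow> \<tau> i \<le> T" and T: "0 < T"
    and s: "\<And>i. i \<in> I \<Longrightarrow> 0 \<le> s i" and constr: "(\<Sum>i\<in>I. \<tau> i * s i powr p) = 1"
  shows "T powr (- 2 / p) \<le> (\<Sum>i\<in>I. (s i)\<^sup>2)"
proof -
  define Q where "Q = (\<Sum>i\<in>I. (s i)\<^sup>2)"
  have Q: "0 \<le> Q" by (simp add: Q_def sum_nonneg)
  have s_le: "s i powr p \<le> (s i)\<^sup>2 * Q powr ((p - 2) / 2)" if "i \<in> I" for i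
  proof (cases "s i = 0")
    case False
    hence si: "0 < s i" using s[OF that] by simp
    have "s i powr p = s i powr 2 * s i powr (p - 2)" by (simp flip: powr_add)
    also have "s i powr (p - 2) = (s i powr 2) powr ((p - 2) / 2)"
    proof -
      have "2 * ((p - 2) / 2) = p - 2" by simp
      thus ?thesis by (simp only: powr_powr)
    qed
    also have "s i powr 2 = (s i)\<^sup>2" using si by simp
    also have "((s i)\<^sup>2) powr ((p - 2) / 2) \<le> Q powr ((p - 2) / 2)"
      unfolding Q_def using p fin that by (intro powr_mono2 member_le_sum) auto
    finally show ?thesis by (simp add: mult_left_mono)
  qed simp
  have "1 \<le> (\<Sum>i\<in>I. T * ((s i)\<^sup>2 * Q powr ((p - 2) / 2)))"
    unfolding constr[symmetric]
    by (intro sum_mono mult_mono s_le \<tau>) (use T in auto)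
  also have "\<dots> = T * (Q * Q powr ((p - 2) / 2))"
    by (simp add: Q_def sum_distrib_left sum_distrib_right)
  also have "Q * Q powr ((p - 2) / 2) = Q powr (1 + (p - 2) / 2)"
    using Q by (cases "Q = 0") (auto simp: powr_add)
  also have "1 + (p - 2) / 2 = p / 2" by (simp add: field_simps)
  finally have "1 powr (2 / p) \<le> (T * Q powr (p / 2)) powr (2 / p)"
    using p by (intro powr_mono2) auto
  also have "\<dots> = T powr (2 / p) * Q"
    using p Q T by (simp add: powr_mult powr_powr)
  finally show ?thesis using T by (simp add: powr_minus field_simps flip: Q_def)
qed

section \<open>Minimizing the trace\<close>

lemma has_minI:
  assumes "\<And>A. A \<in> \<A> \<Longrightarrow> c \<le> objective \<Delta> A" "A\<^sub>0 \<in> \<A>" "objective \<Delta> A\<^sub>0 = c"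
  shows "has_min \<Delta> \<A> c"
  unfolding has_min_def
proof (intro conjI)
  show "bdd_below (objective \<Delta> ` \<A>)" using assms(1) by (auto intro!: bdd_belowI)
  show "Inf (objective \<Delta> ` \<A>) = c"
    by (rule cInf_eq_minimum) (use assms in auto)
qed (use assms in auto)

lemma minimizers_eq:
  assumes "has_min \<Delta> \<A> c"
  shows "minimizers \<Delta> \<A> = {A \<in> \<A>. objective \<Delta> A = c}"
  using assms by (auto simp: minimizers_def has_min_def)

lemma diag_eq_real_diag: "diag n d = real_diag n (\<lambda>i. d (Suc i))"
  by (simp add: diag_def)

lemma diagonalizers_iff:
  "U \<in> diagonalizers n \<Delta> \<longleftrightarrow> U \<in> unitaries n \<and>
     \<Delta> = U * real_diag n (\<lambda>i. eig \<Delta> (n - i)) * mat_adjoint U"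
proof -
  have "diag n (\<lambda>j. eig \<Delta> (n - j + 1)) = real_diag n (\<lambda>i. eig \<Delta> (n - i))"
    unfolding diag_eq_real_diag by (intro mat_diag_cong) (simp add: Suc_diff_Suc)
  thus ?thesis by (simp add: diagonalizers_def)
qed

lemma diagonalizers_unitary: "U \<in> diagonalizers n \<Delta> \<Longrightarrow> U \<in> unitaries n"
  by (simp add: diagonalizers_def)

lemma eig_gram_nonneg:
  assumes A: "A \<in> carrier_mat n n" and "i < n"
  shows "0 \<le> eig (mat_adjoint A * A) (Suc i)"
proof -
  obtain W where "W \<in> unitaries n" "mat_adjoint A * A =
      W * real_diag n (\<lambda>i. eig (mat_adjoint A * A) (Suc i)) * mat_adjoint W"
    using diagonalize_descending[OF gram_hermitian[OF A]] by blast
  from gram_spectrum[OF A this \<open>i < n\<close>] show ?thesis .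
qed

lemma sing_val_nonneg: "A \<in> carrier_mat n n \<Longrightarrow> i < n \<Longrightarrow> 0 \<le> sing_val A (Suc i)"
  by (simp add: sing_val_def eig_gram_nonneg)

lemma sing_val_power2:
  "A \<in> carrier_mat n n \<Longrightarrow> i < n \<Longrightarrow> (sing_val A (Suc i))\<^sup>2 = eig (mat_adjoint A * A) (Suc i)"
  by (simp add: sing_val_def eig_gram_nonneg)

lemma sing_val_antimono:
  "A \<in> carrier_mat n n \<Longrightarrow> i \<le> j \<Longrightarrow> j < n \<Longrightarrow> sing_val A (Suc j) \<le> sing_val A (Suc i)"
  by (simp add: sing_val_def eig_antimono[OF gram_hermitian])

lemma gram_decomposition:
  assumes "A \<in> carrier_mat n n"
  obtains W where "W \<in> unitaries n"
    "mat_adjoint A * A = W * real_diag n (\<lambda>i. (sing_val A (Suc i))\<^sup>2) * mat_adjoint W"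
proof -
  have "real_diag n (\<lambda>i. eig (mat_adjoint A * A) (Suc i)) =
      real_diag n (\<lambda>i. (sing_val A (Suc i))\<^sup>2)"
    by (intro mat_diag_cong) (simp add: sing_val_power2[OF assms])
  thus thesis using diagonalize_descending[OF gram_hermitian[OF assms]] that by metis
qed

lemma gram_of_decomposition:
  assumes V: "V \<in> unitaries n" and U: "U \<in> unitaries n"
  shows "mat_adjoint (V * real_diag n s * mat_adjoint U) * (V * real_diag n s * mat_adjoint U) =
    U * real_diag n (\<lambda>i. (s i)\<^sup>2) * mat_adjoint U"
proof -
  note Vc = unitaries_carrier[OF V] and Uc = unitaries_carrier[OF U]
  have "mat_adjoint (V * real_diag n s * mat_adjoint U) * (V * real_diag n s * mat_adjoint U) =
      U * (real_diag n s * real_diag n s) * mat_adjoint U"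
    using Vc Uc by (simp add: square_simps[where n=n] unitary_cancel[OF V, of _ n] del: mat_diag_diag)
  thus ?thesis by (simp add: power2_eq_square)
qed

lemma sing_val_of_decomposition:
  assumes V: "V \<in> unitaries n" and U: "U \<in> unitaries n"
    and s: "\<And>i. i < n \<Longrightarrow> 0 \<le> s i" "\<And>i j. i \<le> j \<Longrightarrow> j < n \<Longrightarrow> s j \<le> s i" and i: "i < n"
  shows "sing_val (V * real_diag n s * mat_adjoint U) (Suc i) = s i"
proof -
  have "eig (U * real_diag n (\<lambda>i. (s i)\<^sup>2) * mat_adjoint U) (Suc i) = (s i)\<^sup>2"
    by (rule eig_descending[OF U refl _ i]) (use s in \<open>auto intro!: power_mono\<close>)
  thus ?thesis using s(1)[OF i] by (simp add: sing_val_def gram_of_decomposition[OF V U])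
qed

lemma objective_gram:
  assumes A: "A \<in> carrier_mat n n" and \<Delta>: "\<Delta> \<in> carrier_mat n n"
  shows "objective \<Delta> A = Re (mat_trace (mat_adjoint A * A * \<Delta>))"
proof -
  have "mat_trace (A * \<Delta> * mat_adjoint A) = mat_trace (mat_adjoint A * (A * \<Delta>))"
    by (rule mat_trace_commute[of _ n n]) (use A \<Delta> in auto)
  also have "mat_adjoint A * (A * \<Delta>) = mat_adjoint A * A * \<Delta>"
    using A \<Delta> by (simp add: square_simps[where n=n])
  finally show ?thesis by (simp add: objective_def)
qed

context
  fixes n :: nat and \<Delta> :: "complex mat"
  assumes \<Delta>: "\<Delta> \<in> carrier_mat n n" and \<Delta>h: "mat_adjoint \<Delta> = \<Delta>"
begin

lemma diagonalizers_nonempty: obtains U where "U \<in> diagonalizers n \<Delta>"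
  using diagonalize_ascending[OF \<Delta> \<Delta>h] unfolding diagonalizers_iff by blast

lemma ascending_eig: "i \<le> j \<Longrightarrow> j < n \<Longrightarrow> eig \<Delta> (n - i) \<le> eig \<Delta> (n - j)"
  using eig_antimono[OF \<Delta> \<Delta>h, of "n - Suc j" "n - Suc i"] by (simp add: Suc_diff_Suc)

lemma sing_val_power2_antimono:
  assumes "A \<in> carrier_mat n n" "i \<le> j" "j < n"
  shows "(sing_val A (Suc j))\<^sup>2 \<le> (sing_val A (Suc i))\<^sup>2"
  using sing_val_antimono[OF assms] sing_val_nonneg[OF assms(1,3)] by (intro power_mono)

lemma objective_lower_bound:
  assumes A: "A \<in> carrier_mat n n"
  shows "(\<Sum>i<n. (sing_val A (Suc i))\<^sup>2 * eig \<Delta> (n - i)) \<le> objective \<Delta> A"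
proof -
  obtain W where W: "W \<in> unitaries n"
    "mat_adjoint A * A = W * real_diag n (\<lambda>i. (sing_val A (Suc i))\<^sup>2) * mat_adjoint W"
    using gram_decomposition[OF A] by blast
  obtain U where U: "U \<in> unitaries n"
    "\<Delta> = U * real_diag n (\<lambda>i. eig \<Delta> (n - i)) * mat_adjoint U"
    using diagonalizers_nonempty unfolding diagonalizers_iff by blast
  have "(\<Sum>i<n. (sing_val A (Suc i))\<^sup>2 * eig \<Delta> (n - i)) \<le>
      Re (mat_trace ((W * real_diag n (\<lambda>i. (sing_val A (Suc i))\<^sup>2) * mat_adjoint W) *
        (U * real_diag n (\<lambda>i. eig \<Delta> (n - i)) * mat_adjoint U)))"
    by (rule trace_inequality[OF ascending_eig sing_val_power2_antimono[OF A] W(1) U(1)])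
  thus ?thesis unfolding objective_gram[OF A \<Delta>] W(2)[symmetric] U(2)[symmetric] .
qed

text \<open>
  Equality in the trace inequality provides one unitary \<open>U\<close> that diagonalizes \<open>A\<^sup>* A\<close> in
  decreasing and \<open>\<Delta>\<close> in increasing order, and \<open>A\<close> has a singular value decomposition along it.
\<close>

lemma objective_bound_tight:
  assumes A: "A \<in> carrier_mat n n"
    and tight: "objective \<Delta> A \<le> (\<Sum>i<n. (sing_val A (Suc i))\<^sup>2 * eig \<Delta> (n - i))"
  obtains V U where "V \<in> unitaries n" "U \<in> diagonalizers n \<Delta>"
    "A = V * real_diag n (\<lambda>i. sing_val A (Suc i)) * mat_adjoint U"
proof -
  obtain W where W: "W \<in> unitaries n"
    "mat_adjoint A * A = W * real_diag n (\<lambda>i. (sing_val A (Suc i))\<^sup>2) * mat_adjoint W"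
    using gram_decomposition[OF A] by blast
  obtain U\<^sub>0 where U\<^sub>0: "U\<^sub>0 \<in> unitaries n"
    "\<Delta> = U\<^sub>0 * real_diag n (\<lambda>i. eig \<Delta> (n - i)) * mat_adjoint U\<^sub>0"
    using diagonalizers_nonempty unfolding diagonalizers_iff by blast
  obtain U where U: "U \<in> unitaries n"
    "mat_adjoint A * A = U * real_diag n (\<lambda>i. (sing_val A (Suc i))\<^sup>2) * mat_adjoint U"
    "\<Delta> = U * real_diag n (\<lambda>i. eig \<Delta> (n - i)) * mat_adjoint U"
    using trace_equality_simultaneous[OF ascending_eig sing_val_power2_antimono[OF A] W U\<^sub>0
        tight[unfolded objective_gram[OF A \<Delta>]]] by blast
  obtain V where "V \<in> unitaries n"
    "A = V * real_diag n (\<lambda>i. sing_val A (Suc i)) * mat_adjoint U"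
    using singular_value_decomposition[OF A U(1,2) sing_val_nonneg[OF A] sing_val_antimono[OF A]]
    by blast
  with U that show thesis unfolding diagonalizers_iff by blast
qed

lemma objective_of_decomposition:
  assumes V: "V \<in> unitaries n" and U: "U \<in> diagonalizers n \<Delta>"
  shows "objective \<Delta> (V * real_diag n s * mat_adjoint U) = (\<Sum>i<n. (s i)\<^sup>2 * eig \<Delta> (n - i))"
proof -
  have Uu: "U \<in> unitaries n"
    and U_diag: "\<Delta> = U * real_diag n (\<lambda>i. eig \<Delta> (n - i)) * mat_adjoint U"
    using U unfolding diagonalizers_iff by blast+
  have "V * real_diag n s * mat_adjoint U \<in> carrier_mat n n"
    using unitaries_carrier[OF V] unitaries_carrier[OF Uu] by (simp add: square_simps[where n=n])
  hence "objective \<Delta> (V * real_diag n s * mat_adjoint U) =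
      Re (mat_trace ((U * real_diag n (\<lambda>i. (s i)\<^sup>2) * mat_adjoint U) *
        (U * real_diag n (\<lambda>i. eig \<Delta> (n - i)) * mat_adjoint U)))"
    unfolding objective_gram[OF _ \<Delta>] gram_of_decomposition[OF V Uu] U_diag[symmetric]
    by (simp add: objective_gram[OF _ \<Delta>] gram_of_decomposition[OF V Uu])
  also have "\<dots> = (\<Sum>i<n. \<Sum>j<n. if i = j then (s i)\<^sup>2 * eig \<Delta> (n - j) else 0)"
    unfolding trace_formula[OF Uu Uu] unitaries_left[OF Uu] Re_complex_of_real
    by (intro sum.cong refl) auto
  also have "\<dots> = (\<Sum>i<n. (s i)\<^sup>2 * eig \<Delta> (n - i))" by simp
  finally show ?thesis .
qed

end

lemma nonneg_invertible_eig_pos: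
  assumes \<Delta>: "\<Delta> \<in> nonneg_hermitian n" "invertible_mat \<Delta>" and i: "i < n"
  shows "0 < eig \<Delta> (n - i)"
proof -
  have c: "\<Delta> \<in> carrier_mat n n" "mat_adjoint \<Delta> = \<Delta>" using \<Delta> by (auto simp: nonneg_hermitian_def)
  obtain U where U: "U \<in> unitaries n"
    "\<Delta> = U * real_diag n (\<lambda>i. eig \<Delta> (n - i)) * mat_adjoint U"
    using diagonalize_ascending[OF c] by blast
  show ?thesis
    using nonneg_hermitian_spectrum[OF \<Delta>(1) U i] invertible_spectrum[OF \<Delta>(2) U i] by simp
qed

lemma phi_eq_1_iff:
  assumes t: "t \<in> decreasing_cone n" and p: "0 < p"
  shows "phi n t p A = 1 \<longleftrightarrow> (\<Sum>i<n. t (Suc i) * sing_val A (Suc i) powr p) = 1"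
proof -
  define S where "S = (\<Sum>i<n. t (Suc i) * sing_val A (Suc i) powr p)"
  have "0 \<le> S" unfolding S_def using t by (intro sum_nonneg) (auto simp: decreasing_cone_def)
  have "phi n t p A = S powr (1 / p)" by (simp add: phi_def S_def sum.atLeast1_atMost_eq)
  moreover have "S powr (1 / p) = 1 \<longleftrightarrow> S = 1"
  proof
    assume *: "S powr (1 / p) = 1"
    hence "(S powr (1 / p)) powr p = 1" by simp
    thus "S = 1" using p \<open>0 \<le> S\<close> by (simp add: powr_powr)
  qed simp
  ultimately show ?thesis by (simp add: S_def)
qed

text \<open>
  The minimizer exhibited has rank one: all of its mass sits on an eigenvector of \<open>\<Delta>\<close> for the
  smallest eigenvalue.
\<close>

theorem minimum_for_large_exponent:
  assumes n: "0 < n" and t: "t \<in> decreasing_cone n" "0 < t 1"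
    and \<Delta>: "\<Delta> \<in> nonneg_hermitian n" "invertible_mat \<Delta>" and p: "2 \<le> p"
  shows "has_min \<Delta> (unit_sphere n t p) (t 1 powr (- 2 / p) * eig \<Delta> n)"
proof -
  have c: "\<Delta> \<in> carrier_mat n n" "mat_adjoint \<Delta> = \<Delta>" using \<Delta> by (auto simp: nonneg_hermitian_def)
  have eig_n: "0 < eig \<Delta> n" using nonneg_invertible_eig_pos[OF \<Delta> n] by simp
  obtain U where U: "U \<in> diagonalizers n \<Delta>" using diagonalizers_nonempty[OF c] by blast
  hence Uu: "U \<in> unitaries n" by (rule diagonalizers_unitary)
  define s where "s i = (if i = 0 then t 1 powr (- 1 / p) else 0)" for i :: nat
  define A\<^sub>0 where "A\<^sub>0 = 1\<^sub>m n * real_diag n s * mat_adjoint U"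
  have A\<^sub>0: "A\<^sub>0 \<in> carrier_mat n n"
    using unitaries_carrier[OF Uu] by (simp add: A\<^sub>0_def square_simps[where n=n])
  have sing: "sing_val A\<^sub>0 (Suc i) = s i" if "i < n" for i
    unfolding A\<^sub>0_def by (rule sing_val_of_decomposition[OF one_unitary Uu _ _ that]) (auto simp: s_def)
  show ?thesis
  proof (rule has_minI)
    fix A assume "A \<in> unit_sphere n t p"
    hence A: "A \<in> carrier_mat n n" and constr: "(\<Sum>i<n. t (Suc i) * sing_val A (Suc i) powr p) = 1"
      using phi_eq_1_iff[OF t(1), of p A] p by (auto simp: unit_sphere_def)
    have "t 1 powr (- 2 / p) \<le> (\<Sum>i<n. (sing_val A (Suc i))\<^sup>2)"
      by (rule square_sum_lower_bound[OF _ p _ t(2) _ constr])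
        (use t(1) sing_val_nonneg[OF A] in \<open>auto simp: decreasing_cone_def\<close>)
    hence "t 1 powr (- 2 / p) * eig \<Delta> n \<le> (\<Sum>i<n. (sing_val A (Suc i))\<^sup>2) * eig \<Delta> n"
      using eig_n by simp
    also have "\<dots> = (\<Sum>i<n. (sing_val A (Suc i))\<^sup>2 * eig \<Delta> (n - 0))"
      by (simp add: sum_distrib_right)
    also have "\<dots> \<le> (\<Sum>i<n. (sing_val A (Suc i))\<^sup>2 * eig \<Delta> (n - i))"
      by (intro sum_mono mult_left_mono ascending_eig[OF c]) auto
    also have "\<dots> \<le> objective \<Delta> A" by (rule objective_lower_bound[OF c A])
    finally show "t 1 powr (- 2 / p) * eig \<Delta> n \<le> objective \<Delta> A" .
  next
    have "(\<Sum>i<n. t (Suc i) * sing_val A\<^sub>0 (Suc i) powr p) = (\<Sum>i<n. if i = 0 then t 1 * s 0 powr p else 0)"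
      by (intro sum.cong refl) (auto simp: sing s_def)
    also have "s 0 powr p = t 1 powr (- 1 / p * p)" by (simp only: s_def powr_powr refl if_True)
    also have "- 1 / p * p = - 1" using p by simp
    also have "(\<Sum>i<n. if i = 0 then t 1 * t 1 powr - 1 else 0) = 1"
      using n t(2) by (simp add: powr_minus)
    finally show "A\<^sub>0 \<in> unit_sphere n t p"
      using A\<^sub>0 phi_eq_1_iff[OF t(1), of p A\<^sub>0] p by (simp add: unit_sphere_def)
    have "objective \<Delta> A\<^sub>0 = (\<Sum>i<n. (s i)\<^sup>2 * eig \<Delta> (n - i))"
      unfolding A\<^sub>0_def by (rule objective_of_decomposition[OF c one_unitary U])
    also have "\<dots> = (\<Sum>i<n. if i = 0 then (t 1 powr (- 1 / p))\<^sup>2 * eig \<Delta> n else 0)"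
      by (intro sum.cong refl) (auto simp: s_def)
    also have "\<dots> = (t 1 powr (- 1 / p))\<^sup>2 * eig \<Delta> n" using n by simp
    also have "(t 1 powr (- 1 / p))\<^sup>2 = t 1 powr (- 2 / p)"
      by (simp add: power2_eq_square flip: powr_add)
    finally show "objective \<Delta> A\<^sub>0 = t 1 powr (- 2 / p) * eig \<Delta> n" .
  qed
qed

text \<open>
  In the variables \<open>x i = \<sigma>\<^sub>i\<^sup>2 * \<mu> i\<close> the lower bound for the objective is \<open>\<Sum> x i\<close>, and the
  constraint becomes \<open>\<Sum> a i * x i powr q = 1\<close> with \<open>q = p / 2\<close> and
  \<open>a i = \<tau> i * \<mu> i powr (- q)\<close>. The unique optimum corresponds to \<open>\<sigma>\<^sub>i = k * s i\<close> with
  \<open>k = S powr (- 1 / p)\<close>. As \<open>k * s i\<close> decreases in \<open>i\<close>, it is a possible list of singular values.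
\<close>

theorem minimum_for_small_exponent:
  fixes t :: "nat \<Rightarrow> real" and \<Delta> :: "complex mat" and p :: real
  assumes n: "0 < n" and t: "t \<in> decreasing_cone n" "0 < t 1"
    and \<Delta>: "\<Delta> \<in> nonneg_hermitian n" "invertible_mat \<Delta>" and p: "0 < p" "p < 2"
  defines "S \<equiv> \<Sum>i<n. (t (Suc i) powr (2 / p) * inverse (eig \<Delta> (n - i))) powr (p / (2 - p))"
    and "s \<equiv> \<lambda>i. (t (Suc i) * inverse (eig \<Delta> (n - i))) powr (1 / (2 - p))"
  shows "has_min \<Delta> (unit_sphere n t p) (S powr ((p - 2) / p))"
    and "minimizers \<Delta> (unit_sphere n t p) =
      {complex_of_real (S powr (- 1 / p)) \<cdot>\<^sub>m (V * real_diag n s * mat_adjoint U) | V U.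
        V \<in> unitaries n \<and> U \<in> diagonalizers n \<Delta>}"
proof -
  have c: "\<Delta> \<in> carrier_mat n n" "mat_adjoint \<Delta> = \<Delta>" using \<Delta> by (auto simp: nonneg_hermitian_def)
  define \<tau> where "\<tau> i = t (Suc i)" for i
  define \<mu> where "\<mu> i = eig \<Delta> (n - i)" for i
  have \<mu>: "0 < \<mu> i" if "i < n" for i unfolding \<mu>_def by (rule nonneg_invertible_eig_pos[OF \<Delta> that])
  have \<mu>_asc: "\<mu> i \<le> \<mu> j" if "i \<le> j" "j < n" for i j
    unfolding \<mu>_def by (rule ascending_eig[OF c that])
  have \<tau>: "0 \<le> \<tau> i" if "i < n" for i using t(1) that by (auto simp: \<tau>_def decreasing_cone_def)
  have \<tau>_desc: "\<tau> j \<le> \<tau> i" if "i \<le> j" "j < n" for i j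
    using t(1) that by (auto simp: \<tau>_def decreasing_cone_def)
  define q where "q = p / 2"
  have q: "0 < q" "q < 1" using p by (auto simp: q_def)
  define a where "a i = \<tau> i * \<mu> i powr (- q)" for i
  have a: "0 \<le> a i" if "i < n" for i using \<tau>[OF that] by (simp add: a_def)
  have a0: "0 < a 0" using t(2) \<mu>[OF n] by (simp add: a_def \<tau>_def)
  define w where "w i = a i powr (1 / (1 - q))" for i
  have exps: "1 / (1 - q) = 2 / (2 - p)" "(q - 1) / q = (p - 2) / p" "- 1 / q = - 2 / p"
    using p by (auto simp: q_def field_simps)
  have S_eq: "S = (\<Sum>i<n. w i)"
    unfolding S_def
  proof (intro sum.cong refl)
    fix i assume "i \<in> {..<n}"
    hence i: "i < n" by simp
    have "w i = \<tau> i powr (2 / (2 - p)) * \<mu> i powr (- q * (2 / (2 - p)))"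
      unfolding w_def a_def exps by (simp add: powr_mult powr_powr)
    also have "- q * (2 / (2 - p)) = - (p / (2 - p))" by (simp add: q_def)
    also have "\<tau> i powr (2 / (2 - p)) = (\<tau> i powr (2 / p)) powr (p / (2 - p))"
      using p by (simp add: powr_powr)
    also have "\<mu> i powr (- (p / (2 - p))) = inverse (\<mu> i) powr (p / (2 - p))"
      using \<mu>[OF i] by (simp add: powr_minus inverse_powr)
    finally show "(t (Suc i) powr (2 / p) * inverse (eig \<Delta> (n - i))) powr (p / (2 - p)) = w i"
      by (simp add: powr_mult \<tau>_def \<mu>_def)
  qed
  have S: "0 < S"
    unfolding S_eq using n a0 by (intro sum_pos2[of _ 0]) (auto simp: w_def)
  define k where "k = S powr (- 1 / p)"
  have k: "0 < k" using S by (simp add: k_def)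
  \<comment> \<open>\<open>k * s\<close> is the optimal point of \<open>weighted_powr_sum_minimum\<close>, expressed by singular values.\<close>
  have optimum: "(k * s i)\<^sup>2 * \<mu> i = S powr (- 1 / q) * w i" if i: "i < n" for i
  proof -
    have "k\<^sup>2 = S powr (- 1 / q)"
      unfolding k_def exps by (simp add: power2_eq_square flip: powr_add)
    moreover have "(s i)\<^sup>2 * \<mu> i = w i"
    proof -
      have "(s i)\<^sup>2 = (\<tau> i * inverse (\<mu> i)) powr (2 / (2 - p))"
        by (simp add: s_def \<tau>_def \<mu>_def power2_eq_square flip: powr_add)
      also have "\<dots> = \<tau> i powr (2 / (2 - p)) * \<mu> i powr (- (2 / (2 - p)))"
        using \<mu>[OF i] by (simp add: powr_mult powr_minus inverse_powr)
      finally have "(s i)\<^sup>2 * \<mu> i = \<tau> i powr (2 / (2 - p)) * (\<mu> i powr (- (2 / (2 - p))) * \<mu> i powr 1)"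
        using \<mu>[OF i] by simp
      also have "\<mu> i powr (- (2 / (2 - p))) * \<mu> i powr 1 = \<mu> i powr (- q * (2 / (2 - p)))"
        using p by (simp only: powr_add[symmetric]) (simp add: q_def field_simps)
      also have "\<tau> i powr (2 / (2 - p)) * \<dots> = w i"
        unfolding w_def a_def exps by (simp add: powr_mult powr_powr)
      finally show ?thesis .
    qed
    ultimately show ?thesis by (simp add: power_mult_distrib mult.assoc)
  qed
  have constr_iff: "a i * (x\<^sup>2 * \<mu> i) powr q = \<tau> i * x powr p" if "i < n" "0 \<le> x" for i x
  proof -
    have "(x\<^sup>2) powr q = x powr p"
      using \<open>0 \<le> x\<close> by (cases "x = 0") (auto simp: q_def powr_powr simp flip: powr_numeral)
    thus ?thesis using \<mu>[OF that(1)] by (simp add: a_def powr_mult powr_minus)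
  qed
  have s_nonneg: "0 \<le> k * s i" for i using k by (simp add: s_def)
  have s_desc: "k * s j \<le> k * s i" if "i \<le> j" "j < n" for i j
  proof -
    have "t (Suc j) * inverse (eig \<Delta> (n - j)) \<le> t (Suc i) * inverse (eig \<Delta> (n - i))"
      using \<tau>_desc[OF that] \<mu>_asc[OF that] \<tau>[of j] \<tau>[of i] \<mu>[of i] \<mu>[of j] that
      unfolding \<tau>_def \<mu>_def by (intro mult_mono le_imp_inverse_le) auto
    thus ?thesis
      unfolding s_def using k p \<tau>[of j] \<mu>[of j] that
      by (intro mult_left_mono powr_mono2) (auto simp: \<tau>_def \<mu>_def)
  qed
  have attained_constr: "(\<Sum>i<n. \<tau> i * (k * s i) powr p) = 1"
    and attained_value: "(\<Sum>i<n. (k * s i)\<^sup>2 * \<mu> i) = S powr ((q - 1) / q)"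
  proof -
    have "(\<Sum>i<n. (k * s i)\<^sup>2 * \<mu> i) = S powr (- 1 / q) * S"
      by (simp add: optimum S_eq sum_distrib_left)
    also have "\<dots> = S powr (- 1 / q) * S powr 1" using S by simp
    also have "\<dots> = S powr (- 1 / q + 1)" by (simp only: powr_add)
    also have "- 1 / q + 1 = (q - 1) / q" using q by (simp add: field_simps)
    finally show "(\<Sum>i<n. (k * s i)\<^sup>2 * \<mu> i) = S powr ((q - 1) / q)" .
    have "\<tau> i * (k * s i) powr p = w i * S powr - 1" if i: "i < n" for i
    proof -
      have "\<tau> i * (k * s i) powr p = a i * (S powr (- 1 / q) * w i) powr q"
        using constr_iff[OF i s_nonneg[of i]] by (simp add: optimum[OF i])
      also have "\<dots> = S powr - 1 * (a i * w i powr q)"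
        using q by (simp add: powr_mult powr_powr)
      also have "a i * w i powr q = w i"
      proof (cases "a i = 0")
        case False
        hence "0 < a i" using a[OF i] by simp
        hence "a i * w i powr q = a i powr (1 + 1 / (1 - q) * q)"
          by (simp add: w_def powr_powr powr_add)
        also have "1 + 1 / (1 - q) * q = 1 / (1 - q)" using q by (simp add: field_simps)
        finally show ?thesis by (simp add: w_def)
      qed (use q in \<open>simp add: w_def\<close>)
      finally show ?thesis by simp
    qed
    hence "(\<Sum>i<n. \<tau> i * (k * s i) powr p) = (\<Sum>i<n. w i * S powr - 1)"
      by (intro sum.cong) auto
    also have "\<dots> = S * S powr - 1" unfolding S_eq sum_distrib_right ..
    finally have "(\<Sum>i<n. \<tau> i * (k * s i) powr p) = S * S powr - 1" .
    thus "(\<Sum>i<n. \<tau> i * (k * s i) powr p) = 1" using S by (simp add: powr_minus)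
  qed
  have smult: "complex_of_real k \<cdot>\<^sub>m (V * real_diag n s * mat_adjoint U) =
      V * real_diag n (\<lambda>i. k * s i) * mat_adjoint U"
    if "V \<in> unitaries n" "U \<in> unitaries n" for V U
  proof -
    note [simp] = unitaries_carrier[OF that(1)] unitaries_carrier[OF that(2)]
    have "real_diag n (\<lambda>i. k * s i) = complex_of_real k \<cdot>\<^sub>m real_diag n s"
      by (intro eq_matI) (auto simp: mat_diag_def)
    thus ?thesis
      by (simp add: mult_smult_distrib[of _ n n _ n] mult_smult_assoc_mat[of _ n n _ n]
          square_simps[where n=n])
  qed
  have attained: "V * real_diag n (\<lambda>i. k * s i) * mat_adjoint U \<in> unit_sphere n t p"
    "objective \<Delta> (V * real_diag n (\<lambda>i. k * s i) * mat_adjoint U) = S powr ((p - 2) / p)"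
    if V: "V \<in> unitaries n" and U: "U \<in> diagonalizers n \<Delta>" for V U
  proof -
    have Uu: "U \<in> unitaries n" by (rule diagonalizers_unitary[OF U])
    let ?A = "V * real_diag n (\<lambda>i. k * s i) * mat_adjoint U"
    have "?A \<in> carrier_mat n n"
      using unitaries_carrier[OF V] unitaries_carrier[OF Uu] by (simp add: square_simps[where n=n])
    moreover have "(\<Sum>i<n. t (Suc i) * sing_val ?A (Suc i) powr p) = 1"
      using attained_constr sing_val_of_decomposition[OF V Uu s_nonneg s_desc]
      by (simp add: \<tau>_def)
    ultimately show "?A \<in> unit_sphere n t p"
      using phi_eq_1_iff[OF t(1) p(1)] by (simp add: unit_sphere_def)
    show "objective \<Delta> ?A = S powr ((p - 2) / p)"
      unfolding objective_of_decomposition[OF c V U] using attained_value by (simp add: \<mu>_def exps)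
  qed
  have lower: "S powr ((p - 2) / p) \<le> (\<Sum>i<n. (sing_val A (Suc i))\<^sup>2 * \<mu> i)"
    and lower_tight: "(\<Sum>i<n. (sing_val A (Suc i))\<^sup>2 * \<mu> i) \<le> S powr ((p - 2) / p) \<Longrightarrow> i < n \<Longrightarrow>
      sing_val A (Suc i) = k * s i"
    if "A \<in> unit_sphere n t p" for A i
  proof -
    have A: "A \<in> carrier_mat n n" and constr: "(\<Sum>i<n. \<tau> i * sing_val A (Suc i) powr p) = 1"
      using that phi_eq_1_iff[OF t(1) p(1), of A] by (auto simp: unit_sphere_def \<tau>_def)
    have constr': "(\<Sum>i<n. a i * ((sing_val A (Suc i))\<^sup>2 * \<mu> i) powr q) = 1"
      using constr by (simp add: constr_iff sing_val_nonneg[OF A])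
    have x: "0 \<le> (sing_val A (Suc i))\<^sup>2 * \<mu> i" if "i \<in> {..<n}" for i
      using \<mu>[of i] that by simp
    note minimum = weighted_powr_sum_minimum[of "{..<n}" q a "\<lambda>i. (sing_val A (Suc i))\<^sup>2 * \<mu> i" 0,
        OF _ q _ x _ a0 constr', folded w_def, folded S_eq, unfolded exps(2)]
    show "S powr ((p - 2) / p) \<le> (\<Sum>i<n. (sing_val A (Suc i))\<^sup>2 * \<mu> i)"
      by (rule minimum(1)) (use a n in auto)
    assume tight: "(\<Sum>i<n. (sing_val A (Suc i))\<^sup>2 * \<mu> i) \<le> S powr ((p - 2) / p)" and i: "i < n"
    have "(sing_val A (Suc i))\<^sup>2 * \<mu> i = S powr (- 1 / q) * w i"
      by (rule minimum(2)[OF _ _ _ _ tight]) (use a n i in auto)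
    hence "(sing_val A (Suc i))\<^sup>2 * \<mu> i = (k * s i)\<^sup>2 * \<mu> i" unfolding optimum[OF i] .
    hence "(sing_val A (Suc i))\<^sup>2 = (k * s i)\<^sup>2" using \<mu>[OF i] by simp
    thus "sing_val A (Suc i) = k * s i"
      using sing_val_nonneg[OF A i] s_nonneg[of i] by simp
  qed
  show has_min: "has_min \<Delta> (unit_sphere n t p) (S powr ((p - 2) / p))"
  proof -
    obtain U where "U \<in> diagonalizers n \<Delta>" using diagonalizers_nonempty[OF c] by blast
    note opt = attained[OF one_unitary this]
    show ?thesis
    proof (rule has_minI[OF _ opt])
      fix A assume A: "A \<in> unit_sphere n t p"
      hence "A \<in> carrier_mat n n" by (simp add: unit_sphere_def)
      from lower[OF A] objective_lower_bound[OF c this]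
      show "S powr ((p - 2) / p) \<le> objective \<Delta> A" by (simp add: \<mu>_def)
    qed
  qed
  show "minimizers \<Delta> (unit_sphere n t p) =
      {complex_of_real (S powr (- 1 / p)) \<cdot>\<^sub>m (V * real_diag n s * mat_adjoint U) | V U.
        V \<in> unitaries n \<and> U \<in> diagonalizers n \<Delta>}"
    unfolding minimizers_eq[OF has_min] k_def[symmetric]
  proof (intro Set.set_eqI iffI)
    fix A assume "A \<in> {A \<in> unit_sphere n t p. objective \<Delta> A = S powr ((p - 2) / p)}"
    hence A: "A \<in> unit_sphere n t p" and obj: "objective \<Delta> A = S powr ((p - 2) / p)" by auto
    have Ac: "A \<in> carrier_mat n n" using A by (simp add: unit_sphere_def)
    have "objective \<Delta> A \<le> (\<Sum>i<n. (sing_val A (Suc i))\<^sup>2 * eig \<Delta> (n - i))"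
      using lower[OF A] obj by (simp add: \<mu>_def)
    from objective_bound_tight[OF c Ac this] obtain V U where V: "V \<in> unitaries n"
      and U: "U \<in> diagonalizers n \<Delta>"
      and A_eq: "A = V * real_diag n (\<lambda>i. sing_val A (Suc i)) * mat_adjoint U" by blast
    have tight: "(\<Sum>i<n. (sing_val A (Suc i))\<^sup>2 * \<mu> i) \<le> S powr ((p - 2) / p)"
      using objective_lower_bound[OF c Ac] obj by (simp add: \<mu>_def)
    have "real_diag n (\<lambda>i. sing_val A (Suc i)) = real_diag n (\<lambda>i. k * s i)"
      by (intro mat_diag_cong) (simp only: lower_tight[OF A tight])
    with A_eq have "A = complex_of_real k \<cdot>\<^sub>m (V * real_diag n s * mat_adjoint U)"
      using smult[OF V diagonalizers_unitary[OF U]] by simp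
    thus "A \<in> {complex_of_real k \<cdot>\<^sub>m (V * real_diag n s * mat_adjoint U) | V U.
        V \<in> unitaries n \<and> U \<in> diagonalizers n \<Delta>}" using V U by blast
  next
    fix A assume "A \<in> {complex_of_real k \<cdot>\<^sub>m (V * real_diag n s * mat_adjoint U) | V U.
        V \<in> unitaries n \<and> U \<in> diagonalizers n \<Delta>}"
    then obtain V U where V: "V \<in> unitaries n" and U: "U \<in> diagonalizers n \<Delta>"
      and A: "A = complex_of_real k \<cdot>\<^sub>m (V * real_diag n s * mat_adjoint U)" by blast
    from attained[OF V U] smult[OF V diagonalizers_unitary[OF U]]
    show "A \<in> {A \<in> unit_sphere n t p. objective \<Delta> A = S powr ((p - 2) / p)}"
      unfolding A by simp
  qed
qed

theorem proposition4p2: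
  fixes n :: nat and t :: "nat \<Rightarrow> real" and p :: real
    and \<Delta> :: "complex mat" and l :: "nat \<Rightarrow> real"
  assumes "n > 0"
    and "t \<in> decreasing_cone n" and "t 1 > 0"
    and "\<Delta> \<in> nonneg_hermitian n" and "invertible_mat \<Delta>"
    and "\<And>j. j \<in> {1..n} \<Longrightarrow> l j = eig \<Delta> j"
  shows "(2 \<le> p \<longrightarrow> has_min \<Delta> (unit_sphere n t p) (t 1 powr (- 2 / p) * l n)) \<and>
    (0 < p \<and> p < 2 \<longrightarrow>
      has_min \<Delta> (unit_sphere n t p)
        ((\<Sum>j = 1..n. (t j powr (2 / p) * inverse (l (n - j + 1))) powr (p / (2 - p)))
          powr ((p - 2) / p)) \<and>
      minimizers \<Delta> (unit_sphere n t p) =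
        {complex_of_real
            ((\<Sum>j = 1..n. (t j powr (2 / p) * inverse (l (n - j + 1))) powr (p / (2 - p)))
              powr (- 1 / p))
          \<cdot>\<^sub>m (V * diag n (\<lambda>j. (t j * inverse (l (n - j + 1))) powr (1 / (2 - p)))
              * mat_adjoint U)
         | V U. V \<in> unitaries n \<and> U \<in> diagonalizers n \<Delta>})"
proof -
  have l: "l (n - Suc i + 1) = eig \<Delta> (n - i)" if "i < n" for i
    using assms(6)[of "n - i"] that by (simp add: Suc_diff_Suc)
  have S: "(\<Sum>j = 1..n. (t j powr (2 / p) * inverse (l (n - j + 1))) powr (p / (2 - p))) =
      (\<Sum>i<n. (t (Suc i) powr (2 / p) * inverse (eig \<Delta> (n - i))) powr (p / (2 - p)))"
    unfolding One_nat_def sum.atLeast1_atMost_eq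
    by (intro sum.cong refl) (simp only: l[unfolded One_nat_def] lessThan_iff)
  have D: "diag n (\<lambda>j. (t j * inverse (l (n - j + 1))) powr (1 / (2 - p))) =
      real_diag n (\<lambda>i. (t (Suc i) * inverse (eig \<Delta> (n - i))) powr (1 / (2 - p)))"
    unfolding diag_eq_real_diag by (intro mat_diag_cong) (simp only: l)
  have "l n = eig \<Delta> n" using assms(1,6) by simp
  show ?thesis
    unfolding S D \<open>l n = eig \<Delta> n\<close>
    using minimum_for_large_exponent[OF assms(1-5)] minimum_for_small_exponent[OF assms(1-5)]
    by blast
qed

end
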